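(* Let $\Gamma$ be a normal spherically homogeneous rooted tree of type $\{L_n,k_n\}_{n=1}^\infty$. Let $$M_n=\begin{cases}\prod_{j=1}^n k_j-\prod_{j=1}^{n-1}k_j & n>1,\\ k_1-1 & n=1,\\ 1 & n=0.\end{cases}$$ Let $R_0=0$ and $R_n=L_n+1$ for $n\ge 1$. Then $\Delta$ on $\ell^2(\Gamma)$ is unitarily equivalent to a direct sum of Jacobi matrices, each operating on a copy of $\ell^2(\mathbb{Z}^+)$: $$\Delta\cong\bigoplus_{n=0}^\infty\bigl(\underbrace{J_n\oplus J_n\oplus\cdots\oplus J_n}_{M_n\text{ times}}\bigr),$$ where $J_n=J(\{a_n(j)\}_{j=1}^\infty,\{b_n(j)\}_{j=1}^\infty)$ with $$a_n(j)=\begin{cases}\sqrt{k_m} & \text{if } j=R_m-R_n\text{ for some } m>n,\\ 1 & \text{otherwise,}\end{cases}\qquad b_n(j)\equiv 0 .$$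
   Context: Distance $d(x,y)$ between vertices of a tree is the number of edges of the unique path joining them. A rooted tree with root $O$ is spherically homogeneous (SH) if every vertex at distance $j$ from $O$ is connected with exactly $\kappa_j$ vertices at distance $j+1$ from $O$, where $\kappa_j$ depends only on $j$; a locally finite SH rooted tree is uniquely determined by $\{\kappa_j\}_{j=0}^\infty$. Given natural numbers $k_n>1$ and a strictly increasing sequence of natural numbers $L_n$ ($n\ge1$), the SH rooted tree is of type $\{L_n,k_n\}_{n=1}^\infty$ if $\kappa_j=k_n$ when $j=L_n$ for some $n$, and $\kappa_j=1$ otherwise. Such a tree is called normal if: $\{k_n\}$ unbounded implies $\limsup_{n\to\infty}(L_{n+1}-L_n)>1$. The Laplacian on $\ell^2(\Gamma)$ (square-summable functions on the vertices) is $(\Delta f)(x)=\sum_{y:\,d(x,y)=1}f(y)$. It is bounded if $\{k_n\}$ is bounded; in general, on a normal SH rooted tree, $\Delta$ is self-adjoint (it is essentially self-adjoint on finitely supported functions, and $\Delta$ denotes the self-adjoint closure). For real $b(j)$ and $a(j)>0$, $J(\{a(j)\}_{j=1}^\infty,\{b(j)\}_{j=1}^\infty)$ denotes the Jacobi matrix on $\ell^2(\mathbb{Z}^+)$, $\mathbb{Z}^+=\{1,2,\dots\}$: the symmetric tridiagonal matrix with diagonal entries $b(1),b(2),\dots$ and off-diagonal entries $J_{j,j+1}=J_{j+1,j}=a(j)$; when unbounded it is regarded as the closure of its action on finitely supported sequences. *)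

theory Defs
  imports "HOL-Analysis.Analysis" "Graph_Theory.Pair_Digraph"
begin

section \<open>Spherically homogeneous rooted trees\<close>

text \<open>
  An undirected graph is a loop-free symmetric digraph without parallel arcs: each edge is
  represented by its two opposite arcs. The predicate \<open>tree\<close> of \<open>Graph_Theory.Digraph_Component\<close>
  is not usable here: the two arcs of an edge would already form a cycle in its sense.
\<close>

definition tree_graph :: "'v pair_pre_digraph \<Rightarrow> bool" where
  "tree_graph T \<longleftrightarrow> pair_bidirected_digraph T \<and>
     (\<forall>x\<in>pverts T. \<forall>y\<in>pverts T. \<exists>!p. pre_digraph.apath (with_proj T) x p y)"

definition tree_dist :: "'v pair_pre_digraph \<Rightarrow> 'v \<Rightarrow> 'v \<Rightarrow> nat" where
  "tree_dist T x y = length (THE p. pre_digraph.apath (with_proj T) x p y)"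

definition children :: "'v pair_pre_digraph \<Rightarrow> 'v \<Rightarrow> 'v \<Rightarrow> 'v set" where
  "children T r x =
     {y \<in> pverts T. (x, y) \<in> parcs T \<and> tree_dist T r y = tree_dist T r x + 1}"

definition spherically_homogeneous ::
    "'v pair_pre_digraph \<Rightarrow> 'v \<Rightarrow> (nat \<Rightarrow> nat) \<Rightarrow> bool" where
  "spherically_homogeneous T r \<kappa> \<longleftrightarrow> tree_graph T \<and> r \<in> pverts T \<and>
     (\<forall>x\<in>pverts T. finite (children T r x) \<and> card (children T r x) = \<kappa> (tree_dist T r x))"

text \<open>
  The sequences \<open>L\<close> and \<open>k\<close> are indexed by \<open>n \<ge> 1\<close>; their values at \<open>0\<close> play no role.
\<close>

definition SH_tree_of_type ::
    "'v pair_pre_digraph \<Rightarrow> 'v \<Rightarrow> (nat \<Rightarrow> nat) \<Rightarrow> (nat \<Rightarrow> nat) \<Rightarrow> bool" where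
  "SH_tree_of_type T r L k \<longleftrightarrow>
     strict_mono_on {1..} L \<and> (\<forall>n\<ge>1. k n > 1) \<and>
     (\<exists>\<kappa>. spherically_homogeneous T r \<kappa> \<and>
        (\<forall>n\<ge>1. \<kappa> (L n) = k n) \<and> (\<forall>j. (\<forall>n\<ge>1. j \<noteq> L n) \<longrightarrow> \<kappa> j = 1))"

definition normal_type :: "(nat \<Rightarrow> nat) \<Rightarrow> (nat \<Rightarrow> nat) \<Rightarrow> bool" where
  "normal_type L k \<longleftrightarrow>
     (\<not> bdd_above (k ` {1..}) \<longrightarrow> limsup (\<lambda>n. ereal (real (L (n + 1)) - real (L n))) > 1)"


section \<open>Square-summable functions and operators\<close>

text \<open>
  A function on a set \<open>X\<close> is represented by its extension by \<open>0\<close> outside \<open>X\<close>.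
\<close>

definition ell2 :: "'a set \<Rightarrow> ('a \<Rightarrow> complex) set" where
  "ell2 X = {f. (\<forall>x. x \<notin> X \<longrightarrow> f x = 0) \<and> (\<lambda>x. (cmod (f x))\<^sup>2) summable_on X}"

definition ell2_inner :: "'a set \<Rightarrow> ('a \<Rightarrow> complex) \<Rightarrow> ('a \<Rightarrow> complex) \<Rightarrow> complex" where
  "ell2_inner X f g = (\<Sum>\<^sub>\<infinity>x\<in>X. cnj (f x) * g x)"

definition ell2_norm :: "'a set \<Rightarrow> ('a \<Rightarrow> complex) \<Rightarrow> real" where
  "ell2_norm X f = sqrt (\<Sum>\<^sub>\<infinity>x\<in>X. (cmod (f x))\<^sup>2)"

definition finsupp :: "'a set \<Rightarrow> ('a \<Rightarrow> complex) set" where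
  "finsupp X = {f. (\<forall>x. x \<notin> X \<longrightarrow> f x = 0) \<and> finite {x. f x \<noteq> 0}}"

text \<open>
  A possibly unbounded operator on \<open>ell2 X\<close> is identified with its graph, the set of pairs
  \<open>(f, g)\<close> such that \<open>f\<close> is in its domain and is mapped to \<open>g\<close>.
\<close>

type_synonym 'a operator = "(('a \<Rightarrow> complex) \<times> ('a \<Rightarrow> complex)) set"

definition op_closure :: "'a set \<Rightarrow> 'a operator \<Rightarrow> 'a operator" where
  "op_closure X S = {(f, g). f \<in> ell2 X \<and> g \<in> ell2 X \<and>
     (\<exists>u v. (\<forall>n. (u n, v n) \<in> S) \<and>
        (\<lambda>n::nat. ell2_norm X (\<lambda>x. u n x - f x)) \<longlonglongrightarrow> 0 \<and>
        (\<lambda>n::nat. ell2_norm X (\<lambda>x. v n x - g x)) \<longlonglongrightarrow> 0)}"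

definition unitary :: "'a set \<Rightarrow> 'b set \<Rightarrow> (('a \<Rightarrow> complex) \<Rightarrow> ('b \<Rightarrow> complex)) \<Rightarrow> bool" where
  "unitary X Y U \<longleftrightarrow> bij_betw U (ell2 X) (ell2 Y) \<and>
     (\<forall>f\<in>ell2 X. \<forall>g\<in>ell2 X. \<forall>c d. U (\<lambda>x. c * f x + d * g x) = (\<lambda>y. c * U f y + d * U g y)) \<and>
     (\<forall>f\<in>ell2 X. \<forall>g\<in>ell2 X. ell2_inner Y (U f) (U g) = ell2_inner X f g)"

text \<open>
  \<open>B = U A U\<^sup>-\<^sup>1\<close>, including equality of the domains.
\<close>

definition unitarily_equivalent ::
    "'a set \<Rightarrow> 'a operator \<Rightarrow> 'b set \<Rightarrow> 'b operator \<Rightarrow> bool" where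
  "unitarily_equivalent X A Y B \<longleftrightarrow>
     (\<exists>U. unitary X Y U \<and> B = (\<lambda>(f, g). (U f, U g)) ` A)"

text \<open>
  The Hilbert space direct sum of the spaces \<open>ell2 (X i)\<close>, \<open>i \<in> I\<close>, is realised as
  \<open>ell2 (Sigma I X)\<close>: a family \<open>f\<^sub>i\<close> with \<open>\<Sum>\<^sub>i \<parallel>f\<^sub>i\<parallel>\<^sup>2 < \<infinity>\<close> is the function \<open>(i, x) \<mapsto> f\<^sub>i x\<close>.
\<close>

definition op_direct_sum ::
    "'i set \<Rightarrow> ('i \<Rightarrow> 'a set) \<Rightarrow> ('i \<Rightarrow> 'a operator) \<Rightarrow> ('i \<times> 'a) operator" where
  "op_direct_sum I X A = {(f, g). f \<in> ell2 (Sigma I X) \<and> g \<in> ell2 (Sigma I X) \<and>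
     (\<forall>i\<in>I. ((\<lambda>x. f (i, x)), (\<lambda>x. g (i, x))) \<in> A i)}"


section \<open>Laplacians and Jacobi matrices\<close>

definition laplacian_action :: "'v pair_pre_digraph \<Rightarrow> ('v \<Rightarrow> complex) \<Rightarrow> ('v \<Rightarrow> complex)" where
  "laplacian_action T f =
     (\<lambda>x. if x \<in> pverts T then \<Sum>y\<in>{y \<in> pverts T. tree_dist T x y = 1}. f y else 0)"

definition laplacian :: "'v pair_pre_digraph \<Rightarrow> 'v operator" where
  "laplacian T =
     op_closure (pverts T) {(f, laplacian_action T f) | f. f \<in> finsupp (pverts T)}"

definition jacobi_entry :: "(nat \<Rightarrow> real) \<Rightarrow> (nat \<Rightarrow> real) \<Rightarrow> nat \<Rightarrow> nat \<Rightarrow> real" where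
  "jacobi_entry a b i j =
     (if i = j then b i else if j = i + 1 then a i else if i = j + 1 then a j else 0)"

text \<open>
  Only applied to finitely supported \<open>f\<close>, so the sum is finite.
\<close>

definition jacobi_action ::
    "(nat \<Rightarrow> real) \<Rightarrow> (nat \<Rightarrow> real) \<Rightarrow> (nat \<Rightarrow> complex) \<Rightarrow> (nat \<Rightarrow> complex)" where
  "jacobi_action a b f =
     (\<lambda>i. if i \<in> {1..} then \<Sum>j\<in>{j. f j \<noteq> 0}. of_real (jacobi_entry a b i j) * f j else 0)"

definition jacobi :: "(nat \<Rightarrow> real) \<Rightarrow> (nat \<Rightarrow> real) \<Rightarrow> nat operator" where
  "jacobi a b = op_closure {1..} {(f, jacobi_action a b f) | f. f \<in> finsupp {1..}}"


section \<open>The decomposition data of a spherically homogeneous tree\<close>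

text \<open>
  The truncated subtractions below never underflow under the hypotheses \<open>k n > 1\<close> and
  \<open>L\<close> strictly increasing, and these also make the index \<open>m\<close> in \<open>SH_a\<close> unique.
\<close>

definition SH_M :: "(nat \<Rightarrow> nat) \<Rightarrow> nat \<Rightarrow> nat" where
  "SH_M k n = (if n = 0 then 1 else if n = 1 then k 1 - 1
     else (\<Prod>j=1..n. k j) - (\<Prod>j=1..n-1. k j))"

definition SH_R :: "(nat \<Rightarrow> nat) \<Rightarrow> nat \<Rightarrow> nat" where
  "SH_R L n = (if n = 0 then 0 else L n + 1)"

definition SH_a :: "(nat \<Rightarrow> nat) \<Rightarrow> (nat \<Rightarrow> nat) \<Rightarrow> nat \<Rightarrow> nat \<Rightarrow> real" where
  "SH_a L k n j =
     (if \<exists>m>n. j = SH_R L m - SH_R L n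
      then sqrt (real (k (THE m. m > n \<and> j = SH_R L m - SH_R L n))) else 1)"

definition SH_b :: "nat \<Rightarrow> nat \<Rightarrow> real" where
  "SH_b n j = 0"

end

theory Submission
  imports Defs
begin

text \<open>
  Functions on level \<open>l\<close> of the tree embed isometrically into functions on level \<open>l + 1\<close>: make
  them constant on siblings and divide by the square root of the branching number. The orthogonal
  complement of the image consists of the functions whose sum over the successors of each vertex
  vanishes; the nontrivial Fourier modes on the successor sets form an orthonormal basis of it.
  Lifting each mode through all later levels gives an orthonormal chain on which the Laplacian acts
  as a Jacobi matrix, and all chains together, with the one starting at the root, are an
  orthonormal basis of finitely supported functions. The transition matrix is block diagonal with
  finite blocks, hence matches finitely supported functions with finitely supported functions, so
  the equivalence passes to the closures.
\<close>

section \<open>Paths in rooted trees\<close>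

text \<open>The Laplacian is the sum of two mutually adjoint parts: one sums a function over the
  successors of each vertex, the other copies the value at the parent. From level \<open>l\<close>
  to the next, copying is \<open>sqrt (\<kappa> l)\<close> times the isometric lift, which is where
  the off-diagonal entries come from. Summing over successors undoes a lift with the same factor and
  kills the nontrivial modes, so a chain has no coupling towards the root at its start. Branching
  happens only at the levels \<open>L n\<close>; apart from the root chain, chains therefore start
  at \<open>L n + 1\<close>, and there are \<open>k n - 1\<close> of them for each vertex on level
  \<open>L n\<close>, in total \<open>SH_M k n\<close>.

  The obstacle is unboundedness: matrix entries alone do not settle the domains. Both sides are
  closures of cores, so the unitary has to carry one core onto the other, and closing an algebraic
  direct sum has to give the Hilbert sum of the closures. Fourier modes are convenient because their
  matrix is symmetric: one orthogonality computation yields both the orthonormality of the chains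
  and their completeness.\<close>

locale rooted_tree =
  fixes T :: "'v pair_pre_digraph" and r :: 'v
  assumes tree: "tree_graph T" and root: "r \<in> pverts T"

sublocale rooted_tree \<subseteq> pair_bidirected_digraph T
  using tree by (simp add: tree_graph_def)

context rooted_tree
begin

abbreviation depth :: "'v \<Rightarrow> nat" where
  "depth \<equiv> tree_dist T r"

definition parent :: "'v \<Rightarrow> 'v" where
  "parent x = (THE u. (u, x) \<in> parcs T \<and> depth x = Suc (depth u))"

lemma ex1_apath: "x \<in> pverts T \<Longrightarrow> y \<in> pverts T \<Longrightarrow> \<exists>!p. apath x p y"
  using tree by (simp add: tree_graph_def)

lemma apath_unique: "apath x p y \<Longrightarrow> apath x q y \<Longrightarrow> p = q"
  using ex1_apath[of x y] awalk_hd_in_verts awalk_last_in_verts awalkI_apath by blast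

lemma tree_dist_eq: "apath x p y \<Longrightarrow> tree_dist T x y = length p"
  unfolding tree_dist_def by (metis apath_unique the_equality)

lemma apath_arc: "(x, y) \<in> parcs T \<Longrightarrow> apath x [(x, y)] y"
  using pair_no_loops[of "(x, y)"] by (auto simp: apath_simps in_arcsD2)

lemma tree_dist_eq_1_iff:
  assumes "x \<in> pverts T" "y \<in> pverts T"
  shows "tree_dist T x y = 1 \<longleftrightarrow> (x, y) \<in> parcs T"
proof
  assume 1: "tree_dist T x y = 1"
  obtain p where p: "apath x p y" using ex1_apath[OF assms] by blast
  with 1 have "length p = 1" by (simp add: tree_dist_eq)
  then obtain e where "p = [e]" by (auto simp: length_Suc_conv)
  with p show "(x, y) \<in> parcs T" by (cases e) (auto simp: apath_simps)
next
  assume "(x, y) \<in> parcs T"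
  then show "tree_dist T x y = 1" using tree_dist_eq[OF apath_arc] by simp
qed

lemma apath_snoc:
  assumes "apath r p x" "(x, y) \<in> parcs T" "y \<notin> set (pawalk_verts r p)"
  shows "apath r (p @ [(x, y)]) y"
proof -
  have "awlast r p = x" using assms(1) awalkI_apath by auto
  then show ?thesis
    using assms apath_arc[OF assms(2)] by (simp add: apath_append_iff)
qed

text \<open>
  By uniqueness, the part of the path from \<open>y\<close> to \<open>x\<close> is the single arc between them.
\<close>

lemma apath_through_neighbour:
  assumes "apath r p x" "(x, y) \<in> parcs T" "y \<in> set (pawalk_verts r p)"
  shows "\<exists>q. p = q @ [(y, x)] \<and> apath r q y"
proof -
  obtain q s where qs: "p = q @ s" "awalk r q y" "awalk y s x"
    using awalk_decomp[of r p x y] assms by (auto simp: apath_def)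
  have last: "awlast r q = y" using qs by auto
  have "apath r q y" "apath y s x"
    using assms(1) last unfolding qs(1) apath_append_iff by auto
  moreover have "s = [(y, x)]"
    using apath_unique[OF \<open>apath y s x\<close>] apath_arc arcs_symmetric assms(2) by blast
  ultimately show ?thesis using qs by blast
qed

text \<open>A neighbour of \<open>x\<close> either lies on the path from the root to
  \<open>x\<close>, and is then its last vertex but one, or it prolongs that path by one
  arc.\<close>

lemma depth_arc:
  assumes "(x, y) \<in> parcs T"
  shows "depth y = Suc (depth x) \<or> depth x = Suc (depth y)"
proof -
  obtain p where p: "apath r p x"
    using ex1_apath[OF root] in_arcsD1[OF assms] by blast
  show ?thesis
  proof (cases "y \<in> set (pawalk_verts r p)")
    case True
    then show ?thesis
      using apath_through_neighbour[OF p assms] p by (auto simp: tree_dist_eq)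
  next
    case False
    then show ?thesis
      using tree_dist_eq[OF apath_snoc[OF p assms]] p by (simp add: tree_dist_eq)
  qed
qed

lemma depth_root: "depth r = 0"
  using tree_dist_eq[of r "[]" r] root by (simp add: apath_simps)

lemma depth_eq_0_iff: "x \<in> pverts T \<Longrightarrow> depth x = 0 \<longleftrightarrow> x = r"
  using ex1_apath[OF root, of x] depth_root
  by (auto simp: tree_dist_eq apath_simps)

text \<open>The parent is the tail of the last arc on the path from the root. For uniqueness, the
  root path of any candidate avoids \<open>x\<close>, hence prolongs to the root path of
  \<open>x\<close>, whose last arc is determined.\<close>

lemma ex1_parent:
  assumes x: "x \<in> pverts T" "x \<noteq> r"
  shows "\<exists>!u. (u, x) \<in> parcs T \<and> depth x = Suc (depth u)"
proof -
  obtain p where p: "apath r p x"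
    using ex1_apath[OF root x(1)] by blast
  have "p \<noteq> []" using p x by (auto simp: apath_simps)
  then obtain q e where qe: "p = q @ [e]" by (cases p rule: rev_cases) auto
  obtain u where e: "e = (u, x)" "(u, x) \<in> parcs T" and q: "apath r q u"
    using p unfolding qe apath_append_iff by (cases e) (auto simp: apath_simps)
  have du: "depth x = Suc (depth u)"
    using tree_dist_eq[OF p] tree_dist_eq[OF q] qe by simp
  have "w = u" if w: "(w, x) \<in> parcs T" "depth x = Suc (depth w)" for w
  proof -
    obtain q' where q': "apath r q' w"
      using ex1_apath[OF root] in_arcsD1[OF w(1)] by blast
    have "x \<notin> set (pawalk_verts r q')"
    proof
      assume "x \<in> set (pawalk_verts r q')"
      then obtain s where "q' = s @ [(x, w)]" "apath r s x"
        using apath_through_neighbour[OF q' w(1)] by blast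
      then show False using w(2) q' by (simp add: tree_dist_eq)
    qed
    then have "p = q' @ [(w, x)]"
      using apath_unique[OF p apath_snoc[OF q' w(1)]] by simp
    then show ?thesis using qe e by simp
  qed
  with e du show ?thesis by blast
qed

lemma parent:
  assumes "x \<in> pverts T" "x \<noteq> r"
  shows "(parent x, x) \<in> parcs T" "depth x = Suc (depth (parent x))"
  unfolding parent_def using theI'[OF ex1_parent[OF assms]] by auto

lemma parent_eqI: "(u, x) \<in> parcs T \<Longrightarrow> depth x = Suc (depth u) \<Longrightarrow> parent x = u"
  using ex1_parent[of x] parent[of x] in_arcsD2[of u x] depth_root by (metis nat.distinct(1))

text \<open>Brings the successor sets into the form used by \<open>homogeneous_tree\<close>, which
  knows only depth and parent.\<close>

lemma children_eq:
  assumes "x \<in> pverts T"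
  shows "children T r x = {y \<in> pverts T. depth y = Suc (depth x) \<and> parent y = x}"
  using parent(1) parent_eqI depth_root unfolding children_def by (auto; metis nat.distinct(1))

text \<open>Depth changes by exactly one along an arc, so every neighbour is either a child or the
  unique parent.\<close>

lemma laplacian_action_eq:
  assumes x: "x \<in> pverts T" and fin: "finite (children T r x)"
  shows "laplacian_action T f x =
    (if x = r then 0 else f (parent x)) + (\<Sum>y\<in>children T r x. f y)"
proof -
  have nb: "{y \<in> pverts T. tree_dist T x y = 1} = {y. (x, y) \<in> parcs T}"
    using tree_dist_eq_1_iff[OF x] in_arcsD2 by auto
  show ?thesis
  proof (cases "x = r")
    case True
    have "{y. (x, y) \<in> parcs T} = children T r x"
      unfolding children_def using depth_arc in_arcsD2 True depth_root by fastforce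
    then show ?thesis using True x nb by (simp add: laplacian_action_def)
  next
    case False
    have "{y. (x, y) \<in> parcs T} = insert (parent x) (children T r x)"
    proof (intro equalityI subsetI)
      fix y assume "y \<in> {y. (x, y) \<in> parcs T}"
      then have y: "(x, y) \<in> parcs T" by simp
      show "y \<in> insert (parent x) (children T r x)"
      proof (cases "depth y = Suc (depth x)")
        case True
        then show ?thesis using y in_arcsD2 by (auto simp: children_def)
      next
        case False
        then have "depth x = Suc (depth y)" using depth_arc[OF y] by blast
        then show ?thesis using parent_eqI[of y x] arcs_symmetric y by simp
      qed
    next
      fix y assume "y \<in> insert (parent x) (children T r x)"
      then show "y \<in> {y. (x, y) \<in> parcs T}"
        using parent[OF x False] arcs_symmetric by (auto simp: children_def)
    qed
    moreover have "parent x \<notin> children T r x"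
      using parent[OF x False] by (simp add: children_def)
    ultimately show ?thesis using False x nb fin by (simp add: laplacian_action_def)
  qed
qed

end

section \<open>Closures and direct sums\<close>

text \<open>Tonelli's theorem for unconditional sums: for nonnegative terms summability and absolute
  summability agree.\<close>

lemma nonneg_summable_on_Sigma_iff:
  fixes f :: "'a \<times> 'b \<Rightarrow> real"
  assumes "\<And>p. 0 \<le> f p"
  shows "f summable_on Sigma A B \<longleftrightarrow>
    (\<forall>x\<in>A. (\<lambda>y. f (x, y)) summable_on B x) \<and> (\<lambda>x. \<Sum>\<^sub>\<infinity>y\<in>B x. f (x, y)) summable_on A"
  using Infinite_Sum.abs_summable_on_Sigma_iff[of f A B] assms by (simp add: infsum_nonneg)

lemma summable_on_small_tail:
  fixes f :: "'a \<Rightarrow> real"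
  assumes "f summable_on A" "0 < e"
  obtains F where "finite F" "F \<subseteq> A" "infsum f (A - F) \<le> e"
proof -
  obtain F where F: "finite F" "F \<subseteq> A" "dist (sum f F) (infsum f A) \<le> e"
    using infsum_finite_approximation[OF assms] by blast
  have "infsum f (F \<union> (A - F)) = infsum f F + infsum f (A - F)"
    using assms(1) F(1)
    by (intro infsum_Un_disjoint) (auto intro: summable_on_subset_banach)
  then have "infsum f A = sum f F + infsum f (A - F)"
    using F by (simp add: Un_absorb1)
  then have "infsum f (A - F) \<le> e"
    using F(3) by (simp add: dist_real_def)
  with F that show ?thesis by blast
qed

section \<open>Square-summable functions and unitaries\<close>

lemma ell2_norm_nonneg [simp]: "0 \<le> ell2_norm X f"
  by (simp add: ell2_norm_def infsum_nonneg)

lemma ell2_norm_squared: "(ell2_norm X f)\<^sup>2 = (\<Sum>\<^sub>\<infinity>x\<in>X. (cmod (f x))\<^sup>2)"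
  by (simp add: ell2_norm_def infsum_nonneg)

lemma ell2_supp: "f \<in> ell2 X \<Longrightarrow> x \<notin> X \<Longrightarrow> f x = 0"
  by (simp add: ell2_def)

lemma cmod_lincomb_squared_le:
  "(cmod (c * a + d * b))\<^sup>2 \<le> 2 * (cmod c)\<^sup>2 * (cmod a)\<^sup>2 + 2 * (cmod d)\<^sup>2 * (cmod b)\<^sup>2"
proof -
  have "(cmod (c * a + d * b))\<^sup>2 \<le> (cmod (c * a) + cmod (d * b))\<^sup>2"
    by (intro power_mono norm_triangle_ineq) simp
  also have "\<dots> \<le> 2 * (cmod (c * a))\<^sup>2 + 2 * (cmod (d * b))\<^sup>2"
    using sum_squares_bound[of "cmod (c * a)" "cmod (d * b)"] by (simp add: power2_sum)
  finally show ?thesis by (simp add: norm_mult power_mult_distrib)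
qed

lemma ell2_lincomb:
  assumes "f \<in> ell2 X" "g \<in> ell2 X"
  shows "(\<lambda>x. c * f x + d * g x) \<in> ell2 X"
proof -
  have "(\<lambda>x. (cmod (c * f x + d * g x))\<^sup>2) summable_on X"
  proof (rule summable_on_comparison_test)
    show "(\<lambda>x. 2 * (cmod c)\<^sup>2 * (cmod (f x))\<^sup>2 + 2 * (cmod d)\<^sup>2 * (cmod (g x))\<^sup>2) summable_on X"
      using assms by (intro summable_on_add summable_on_cmult_right) (auto simp: ell2_def)
  qed (auto simp: cmod_lincomb_squared_le)
  with assms show ?thesis by (simp add: ell2_def)
qed

lemma ell2_diff: "f \<in> ell2 X \<Longrightarrow> g \<in> ell2 X \<Longrightarrow> (\<lambda>x. f x - g x) \<in> ell2 X"
  using ell2_lincomb[of f X g 1 "-1"] by simp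

lemma finsupp_subset_ell2: "finsupp X \<subseteq> ell2 X"
proof
  fix f :: "'a \<Rightarrow> complex" assume f: "f \<in> finsupp X"
  have "(\<lambda>x. (cmod (f x))\<^sup>2) summable_on X \<longleftrightarrow> (\<lambda>x. (cmod (f x))\<^sup>2) summable_on {x. f x \<noteq> 0}"
    using f by (intro summable_on_cong_neutral) (auto simp: finsupp_def)
  then show "f \<in> ell2 X" using f by (simp add: ell2_def finsupp_def)
qed

lemma ell2_inner_abs_summable:
  assumes "f \<in> ell2 X" "g \<in> ell2 X"
  shows "(\<lambda>x. cmod (cnj (f x) * g x)) summable_on X"
proof (rule summable_on_comparison_test)
  show "(\<lambda>x. (cmod (f x))\<^sup>2 + (cmod (g x))\<^sup>2) summable_on X"
    using assms by (intro summable_on_add) (auto simp: ell2_def)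
  fix x
  have "2 * (cmod (f x) * cmod (g x)) \<le> (cmod (f x))\<^sup>2 + (cmod (g x))\<^sup>2"
    using sum_squares_bound[of "cmod (f x)" "cmod (g x)"] by (simp add: mult.assoc)
  moreover have "0 \<le> cmod (f x) * cmod (g x)" by simp
  ultimately show "cmod (cnj (f x) * g x) \<le> (cmod (f x))\<^sup>2 + (cmod (g x))\<^sup>2"
    unfolding norm_mult complex_mod_cnj by linarith
qed simp

lemma ell2_inner_self:
  assumes "f \<in> ell2 X"
  shows "ell2_inner X f f = of_real ((ell2_norm X f)\<^sup>2)"
proof -
  have "((\<lambda>x. (cmod (f x))\<^sup>2) has_sum (ell2_norm X f)\<^sup>2) X"
    using assms by (simp add: ell2_norm_squared ell2_def)
  then have "((\<lambda>x. complex_of_real ((cmod (f x))\<^sup>2)) has_sum of_real ((ell2_norm X f)\<^sup>2)) X"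
    by (rule has_sum_of_real)
  moreover have "(\<lambda>x. complex_of_real ((cmod (f x))\<^sup>2)) = (\<lambda>x. cnj (f x) * f x)"
    by (simp add: fun_eq_iff complex_norm_square mult.commute del: of_real_power)
  ultimately show ?thesis by (simp add: ell2_inner_def infsumI)
qed

lemma unitary_norm:
  assumes "unitary X Y U" "f \<in> ell2 X"
  shows "ell2_norm Y (U f) = ell2_norm X f"
proof -
  have "U f \<in> ell2 Y" using assms by (auto simp: unitary_def bij_betw_def)
  moreover have "ell2_inner Y (U f) (U f) = ell2_inner X f f"
    using assms by (simp add: unitary_def)
  ultimately have "(ell2_norm Y (U f))\<^sup>2 = (ell2_norm X f)\<^sup>2"
    using assms by (simp add: ell2_inner_self del: of_real_power)
  then show ?thesis by simp
qed

lemma unitary_diff: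
  assumes "unitary X Y U" "f \<in> ell2 X" "g \<in> ell2 X"
  shows "U (\<lambda>x. f x - g x) = (\<lambda>y. U f y - U g y)"
proof -
  have "U (\<lambda>x. 1 * f x + (-1) * g x) = (\<lambda>y. 1 * U f y + (-1) * U g y)"
    using assms unfolding unitary_def by blast
  then show ?thesis by simp
qed

lemma unitary_norm_diff:
  assumes "unitary X Y U" "f \<in> ell2 X" "g \<in> ell2 X"
  shows "ell2_norm Y (\<lambda>y. U f y - U g y) = ell2_norm X (\<lambda>x. f x - g x)"
  using unitary_norm[OF assms(1) ell2_diff[OF assms(2,3)]] unitary_diff[OF assms] by simp

section \<open>Closures of operators\<close>

text \<open>The epsilon form replaces sequences, which would have to be synchronised over the
  summands of a direct sum. Squared norms are used because they add up over orthogonal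
  summands.\<close>

lemma mem_op_closure_iff:
  "(f, g) \<in> op_closure X S \<longleftrightarrow> f \<in> ell2 X \<and> g \<in> ell2 X \<and>
    (\<forall>e>0. \<exists>u v. (u, v) \<in> S \<and> (ell2_norm X (\<lambda>x. u x - f x))\<^sup>2 \<le> e
      \<and> (ell2_norm X (\<lambda>x. v x - g x))\<^sup>2 \<le> e)" (is "?L \<longleftrightarrow> _ \<and> _ \<and> ?R")
proof (intro iffI conjI)
  assume ?L
  then show "f \<in> ell2 X" "g \<in> ell2 X" by (auto simp: op_closure_def)
  obtain u v where S: "\<And>n. (u n, v n) \<in> S"
    and lim: "(\<lambda>n::nat. ell2_norm X (\<lambda>x. u n x - f x)) \<longlonglongrightarrow> 0"
      "(\<lambda>n. ell2_norm X (\<lambda>x. v n x - g x)) \<longlonglongrightarrow> 0"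
    using \<open>?L\<close> by (auto simp: op_closure_def)
  show ?R
  proof (intro allI impI)
    fix e :: real assume e: "0 < e"
    have "\<forall>\<^sub>F n in sequentially. (ell2_norm X (\<lambda>x. u n x - f x))\<^sup>2 < e"
      using order_tendstoD(2)[OF tendsto_power[OF lim(1), of 2]] e by simp
    moreover have "\<forall>\<^sub>F n in sequentially. (ell2_norm X (\<lambda>x. v n x - g x))\<^sup>2 < e"
      using order_tendstoD(2)[OF tendsto_power[OF lim(2), of 2]] e by simp
    ultimately have "\<forall>\<^sub>F n in sequentially. (ell2_norm X (\<lambda>x. u n x - f x))\<^sup>2 < e \<and>
        (ell2_norm X (\<lambda>x. v n x - g x))\<^sup>2 < e"
      by (rule eventually_conj)
    then obtain n where "(ell2_norm X (\<lambda>x. u n x - f x))\<^sup>2 < e" "(ell2_norm X (\<lambda>x. v n x - g x))\<^sup>2 < e"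
      by (auto dest: eventually_happens)
    with S show "\<exists>u v. (u, v) \<in> S \<and> (ell2_norm X (\<lambda>x. u x - f x))\<^sup>2 \<le> e
        \<and> (ell2_norm X (\<lambda>x. v x - g x))\<^sup>2 \<le> e"
      by (meson less_imp_le)
  qed
next
  assume R: "f \<in> ell2 X \<and> g \<in> ell2 X \<and> ?R"
  \<comment> \<open>Choosing pairs \<open>p\<close> keeps the two approximating sequences coupled by
    membership in \<open>S\<close>; the tolerance \<open>inverse (real (Suc n))\<close> is positive
    also for \<open>n = 0\<close>.\<close>
  let ?C = "\<lambda>n p. p \<in> S \<and> (ell2_norm X (\<lambda>x. fst p x - f x))\<^sup>2 \<le> inverse (real (Suc n))
      \<and> (ell2_norm X (\<lambda>x. snd p x - g x))\<^sup>2 \<le> inverse (real (Suc n))"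
  have "\<exists>p. ?C n p" for n
  proof -
    have "0 < inverse (real (Suc n))" by simp
    with R obtain u v where "(u, v) \<in> S" "(ell2_norm X (\<lambda>x. u x - f x))\<^sup>2 \<le> inverse (real (Suc n))"
      "(ell2_norm X (\<lambda>x. v x - g x))\<^sup>2 \<le> inverse (real (Suc n))"
      by blast
    then show ?thesis by (intro exI[of _ "(u, v)"]) simp
  qed
  then have "\<exists>p. \<forall>n. ?C n (p n)" by (intro choice allI)
  then obtain p where p: "\<And>n. ?C n (p n)" by blast
  define u v where "u = (\<lambda>n. fst (p n))" and "v = (\<lambda>n. snd (p n))"
  have S: "(u n, v n) \<in> S" for n using p by (simp add: u_def v_def)
  have le: "(ell2_norm X (\<lambda>x. u n x - f x))\<^sup>2 \<le> inverse (real (Suc n))"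
    "(ell2_norm X (\<lambda>x. v n x - g x))\<^sup>2 \<le> inverse (real (Suc n))" for n
    using p by (simp_all add: u_def v_def)
  have lim0: "h \<longlonglongrightarrow> 0" if "\<And>n. 0 \<le> h n" "\<And>n. (h n)\<^sup>2 \<le> inverse (real (Suc n))" for h :: "nat \<Rightarrow> real"
  proof -
    have "(\<lambda>n. (h n)\<^sup>2) \<longlonglongrightarrow> 0"
      by (rule tendsto_sandwich[OF _ _ tendsto_const LIMSEQ_inverse_real_of_nat])
        (use that in auto)
    then show ?thesis using tendsto_real_sqrt[of "\<lambda>n. (h n)\<^sup>2" 0] that(1) by simp
  qed
  have "(\<lambda>n. ell2_norm X (\<lambda>x. u n x - f x)) \<longlonglongrightarrow> 0" "(\<lambda>n. ell2_norm X (\<lambda>x. v n x - g x)) \<longlonglongrightarrow> 0"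
    by (rule lim0[OF _ le(1)] lim0[OF _ le(2)], simp)+
  then have "(\<forall>n. (u n, v n) \<in> S) \<and> (\<lambda>n. ell2_norm X (\<lambda>x. u n x - f x)) \<longlonglongrightarrow> 0 \<and>
      (\<lambda>n. ell2_norm X (\<lambda>x. v n x - g x)) \<longlonglongrightarrow> 0"
    using S by simp
  then show ?L
    unfolding op_closure_def using R by blast
qed

text \<open>\<open>U\<close> preserves distances, so approximations transfer in both directions;
  surjectivity onto \<open>ell2 Y\<close> gives every element of the right-hand closure a
  preimage.\<close>

lemma unitary_image_op_closure:
  assumes U: "unitary X Y U" and S: "S \<subseteq> ell2 X \<times> ell2 X"
  shows "(\<lambda>(f, g). (U f, U g)) ` op_closure X S = op_closure Y ((\<lambda>(f, g). (U f, U g)) ` S)"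
proof -
  have bij: "U ` ell2 X = ell2 Y" using U by (simp add: unitary_def bij_betw_def)
  have image: "(\<exists>u v. (u, v) \<in> (\<lambda>(f, g). (U f, U g)) ` S \<and> P u v) \<longleftrightarrow>
      (\<exists>u v. (u, v) \<in> S \<and> P (U u) (U v))" for P
    by force
  have key: "(U f, U g) \<in> op_closure Y ((\<lambda>(f, g). (U f, U g)) ` S) \<longleftrightarrow> (f, g) \<in> op_closure X S"
    if fg: "f \<in> ell2 X" "g \<in> ell2 X" for f g
  proof -
    have eq: "ell2_norm Y (\<lambda>x. U u x - U f x) = ell2_norm X (\<lambda>x. u x - f x) \<and>
        ell2_norm Y (\<lambda>x. U v x - U g x) = ell2_norm X (\<lambda>x. v x - g x)" if "(u, v) \<in> S" for u v
      using that S fg by (auto intro!: unitary_norm_diff[OF U])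
    have "(\<exists>u v. (u, v) \<in> (\<lambda>(f, g). (U f, U g)) ` S \<and> (ell2_norm Y (\<lambda>x. u x - U f x))\<^sup>2 \<le> e
        \<and> (ell2_norm Y (\<lambda>x. v x - U g x))\<^sup>2 \<le> e) \<longleftrightarrow>
      (\<exists>u v. (u, v) \<in> S \<and> (ell2_norm Y (\<lambda>x. U u x - U f x))\<^sup>2 \<le> e
        \<and> (ell2_norm Y (\<lambda>x. U v x - U g x))\<^sup>2 \<le> e)" for e
      by (rule image)
    moreover have "(\<exists>u v. (u, v) \<in> S \<and> (ell2_norm Y (\<lambda>x. U u x - U f x))\<^sup>2 \<le> e
        \<and> (ell2_norm Y (\<lambda>x. U v x - U g x))\<^sup>2 \<le> e) \<longleftrightarrow>
      (\<exists>u v. (u, v) \<in> S \<and> (ell2_norm X (\<lambda>x. u x - f x))\<^sup>2 \<le> e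
        \<and> (ell2_norm X (\<lambda>x. v x - g x))\<^sup>2 \<le> e)" for e
      by (intro iff_exI) (use eq in auto)
    ultimately show ?thesis
      using fg bij unfolding mem_op_closure_iff by auto
  qed
  have sub: "op_closure Z R \<subseteq> ell2 Z \<times> ell2 Z" for Z :: "'z set" and R
    by (auto simp: op_closure_def)
  show ?thesis
  proof (intro equalityI subsetI)
    fix p assume "p \<in> (\<lambda>(f, g). (U f, U g)) ` op_closure X S"
    then obtain f g where "p = (U f, U g)" "(f, g) \<in> op_closure X S" by auto
    with sub[of X S] show "p \<in> op_closure Y ((\<lambda>(f, g). (U f, U g)) ` S)" by (auto simp: key)
  next
    fix p assume p: "p \<in> op_closure Y ((\<lambda>(f, g). (U f, U g)) ` S)"
    then have "p \<in> ell2 Y \<times> ell2 Y" using sub by blast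
    then obtain f g where "p = (U f, U g)" "f \<in> ell2 X" "g \<in> ell2 X"
      using bij by blast
    with p show "p \<in> (\<lambda>(f, g). (U f, U g)) ` op_closure X S" by (auto simp: key)
  qed
qed

section \<open>Hilbert direct sums\<close>

lemma ell2_Sigma_iff:
  "f \<in> ell2 (Sigma I X) \<longleftrightarrow> (\<forall>p. p \<notin> Sigma I X \<longrightarrow> f p = 0) \<and>
    (\<forall>i\<in>I. (\<lambda>x. f (i, x)) \<in> ell2 (X i)) \<and>
    (\<lambda>i. (ell2_norm (X i) (\<lambda>x. f (i, x)))\<^sup>2) summable_on I"
  unfolding ell2_def mem_Collect_eq ell2_norm_squared
  by (subst nonneg_summable_on_Sigma_iff) auto

lemma ell2_norm_Sigma:
  assumes "f \<in> ell2 (Sigma I X)"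
  shows "(ell2_norm (Sigma I X) f)\<^sup>2 = (\<Sum>\<^sub>\<infinity>i\<in>I. (ell2_norm (X i) (\<lambda>x. f (i, x)))\<^sup>2)"
  using infsum_Sigma_banach[of "\<lambda>p. (cmod (f p))\<^sup>2" I X] assms
  by (simp add: ell2_norm_squared ell2_def)

lemma ell2_norm_component_le:
  assumes f: "f \<in> ell2 (Sigma I X)" and i: "i \<in> I"
  shows "(ell2_norm (X i) (\<lambda>x. f (i, x)))\<^sup>2 \<le> (ell2_norm (Sigma I X) f)\<^sup>2"
proof -
  have "(\<Sum>\<^sub>\<infinity>i\<in>{i}. (ell2_norm (X i) (\<lambda>x. f (i, x)))\<^sup>2) \<le>
      (\<Sum>\<^sub>\<infinity>i\<in>I. (ell2_norm (X i) (\<lambda>x. f (i, x)))\<^sup>2)"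
    using f i unfolding ell2_Sigma_iff by (intro infsum_mono_neutral) auto
  then show ?thesis using f by (simp add: ell2_norm_Sigma)
qed

text \<open>The error budget is \<open>e / 2\<close> for the tail, where the approximant vanishes,
  and \<open>e / 2\<close> shared by the components in \<open>F\<close>. The \<open>+ 1\<close>
  keeps the share well defined for empty \<open>F\<close>.\<close>

lemma ell2_Sigma_truncation:
  assumes f: "f \<in> ell2 (Sigma I X)" and F: "finite F" "F \<subseteq> I"
    and tail: "(\<Sum>\<^sub>\<infinity>i\<in>I - F. (ell2_norm (X i) (\<lambda>x. f (i, x)))\<^sup>2) \<le> e / 2"
    and u: "\<And>i. i \<in> F \<Longrightarrow> u i \<in> ell2 (X i)"
    and close: "\<And>i. i \<in> F \<Longrightarrow> (ell2_norm (X i) (\<lambda>x. u i x - f (i, x)))\<^sup>2 \<le> e / (2 * (real (card F) + 1))"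
    and e: "0 < e"
  shows "(ell2_norm (Sigma I X) (\<lambda>p. (\<lambda>(i, x). if i \<in> F then u i x else 0) p - f p))\<^sup>2 \<le> e"
proof -
  let ?u = "\<lambda>(i, x). if i \<in> F then u i x else 0"
  let ?N = "\<lambda>h i. (ell2_norm (X i) (\<lambda>x. h (i, x)))\<^sup>2"
  have 0: "(\<lambda>x. 0) \<in> ell2 Z" "ell2_norm Z (\<lambda>x. 0) = 0" for Z :: "'b set"
    by (simp_all add: ell2_def ell2_norm_def)
  have "(\<lambda>i. ?N ?u i) summable_on I \<longleftrightarrow> (\<lambda>i. ?N ?u i) summable_on F"
    using F by (intro summable_on_cong_neutral) (auto simp: 0)
  then have "(\<lambda>i. ?N ?u i) summable_on I" using F by simp
  moreover have "?u p = 0" if "p \<notin> Sigma I X" for p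
    using that F u by (cases p) (auto intro: ell2_supp)
  moreover have "(\<lambda>x. ?u (i, x)) \<in> ell2 (X i)" for i
    using u 0(1) by (cases "i \<in> F") auto
  ultimately have U: "?u \<in> ell2 (Sigma I X)" by (auto simp: ell2_Sigma_iff)
  let ?w = "\<lambda>p. ?u p - f p"
  have w: "?w \<in> ell2 (Sigma I X)" using U f by (rule ell2_diff)
  have sumw: "(\<lambda>i. ?N ?w i) summable_on I" using w by (simp add: ell2_Sigma_iff)
  have "(ell2_norm (Sigma I X) ?w)\<^sup>2 = infsum (?N ?w) (F \<union> (I - F))"
    using ell2_norm_Sigma[OF w] F by (simp add: Un_absorb1)
  also have "\<dots> = infsum (?N ?w) F + infsum (?N ?w) (I - F)"
    using F sumw by (intro infsum_Un_disjoint) (auto intro: summable_on_subset_banach)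
  also have "infsum (?N ?w) (I - F) = infsum (?N f) (I - F)"
    by (intro infsum_cong) (simp add: ell2_norm_def)
  also have "infsum (?N ?w) F = (\<Sum>i\<in>F. ?N ?w i)" using F by simp
  also have "\<dots> \<le> (\<Sum>i\<in>F. e / (2 * (real (card F) + 1)))"
    using close by (intro sum_mono) simp
  also have "\<dots> \<le> e / 2" using e by (simp add: field_simps)
  finally show ?thesis using tail by simp
qed

text \<open>The algebraic direct sum of the graphs. If the summands lie in \<open>ell2\<close>,
  square-summability of the whole follows from the finiteness condition.\<close>

definition fin_direct_sum :: "'i set \<Rightarrow> ('i \<Rightarrow> 'a operator) \<Rightarrow> ('i \<times> 'a) operator" where
  "fin_direct_sum I S = {(f, g). (\<forall>i\<in>I. (\<lambda>x. f (i, x), \<lambda>x. g (i, x)) \<in> S i) \<and>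
     finite {i. (\<exists>x. f (i, x) \<noteq> 0) \<or> (\<exists>x. g (i, x) \<noteq> 0)} \<and>
     (\<forall>i x. i \<notin> I \<longrightarrow> f (i, x) = 0 \<and> g (i, x) = 0)}"

lemma fin_direct_sum_subset_ell2:
  assumes S: "\<And>i. i \<in> I \<Longrightarrow> S i \<subseteq> ell2 (X i) \<times> ell2 (X i)"
  shows "fin_direct_sum I S \<subseteq> ell2 (Sigma I X) \<times> ell2 (Sigma I X)"
proof -
  have *: "f \<in> ell2 (Sigma I X)" if out: "\<And>i x. i \<notin> I \<Longrightarrow> f (i, x) = 0"
    and comp: "\<And>i. i \<in> I \<Longrightarrow> (\<lambda>x. f (i, x)) \<in> ell2 (X i)" and fin: "finite {i. \<exists>x. f (i, x) \<noteq> 0}" for f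
  proof -
    have "(\<lambda>i. (ell2_norm (X i) (\<lambda>x. f (i, x)))\<^sup>2) summable_on I \<longleftrightarrow>
      (\<lambda>i. (ell2_norm (X i) (\<lambda>x. f (i, x)))\<^sup>2) summable_on {i. \<exists>x. f (i, x) \<noteq> 0}"
      using out by (intro summable_on_cong_neutral) (auto simp: ell2_norm_def)
    moreover have "f p = 0" if "p \<notin> Sigma I X" for p
      using that out ell2_supp[OF comp] by (cases p) auto
    ultimately show ?thesis using comp fin by (auto simp: ell2_Sigma_iff)
  qed
  show ?thesis
  proof
    fix p assume "p \<in> fin_direct_sum I S"
    then obtain f g where p: "p = (f, g)" and fg: "(f, g) \<in> fin_direct_sum I S" by (cases p) auto
    have "f \<in> ell2 (Sigma I X)" "g \<in> ell2 (Sigma I X)"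
      using fg S by (auto simp: fin_direct_sum_def intro!: * elim: rev_finite_subset)
    then show "p \<in> ell2 (Sigma I X) \<times> ell2 (Sigma I X)" using p by simp
  qed
qed

text \<open>One inclusion holds because restriction to a component does not increase norms. For the
  other, the family is cut off to a finite set of indices and approximated there;
  \<open>zero\<close> admits the components that were cut off.\<close>

lemma op_closure_fin_direct_sum:
  assumes S: "\<And>i. i \<in> I \<Longrightarrow> S i \<subseteq> ell2 (X i) \<times> ell2 (X i)"
    and zero: "\<And>i. i \<in> I \<Longrightarrow> (\<lambda>x. 0, \<lambda>x. 0) \<in> S i"
  shows "op_closure (Sigma I X) (fin_direct_sum I S) =
    op_direct_sum I X (\<lambda>i. op_closure (X i) (S i))"
proof (intro equalityI subsetI)
  fix p assume "p \<in> op_closure (Sigma I X) (fin_direct_sum I S)"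
  then obtain f g where p: "p = (f, g)"
    and fg: "(f, g) \<in> op_closure (Sigma I X) (fin_direct_sum I S)" by (cases p) auto
  have ell2: "f \<in> ell2 (Sigma I X)" "g \<in> ell2 (Sigma I X)"
    using fg by (auto simp: mem_op_closure_iff)
  have "(\<lambda>x. f (i, x), \<lambda>x. g (i, x)) \<in> op_closure (X i) (S i)" if i: "i \<in> I" for i
    unfolding mem_op_closure_iff
  proof (intro conjI allI impI)
    show "(\<lambda>x. f (i, x)) \<in> ell2 (X i)" "(\<lambda>x. g (i, x)) \<in> ell2 (X i)"
      using ell2 i by (auto simp: ell2_Sigma_iff)
    fix e :: real assume "0 < e"
    then obtain u v where uv: "(u, v) \<in> fin_direct_sum I S"
      and le: "(ell2_norm (Sigma I X) (\<lambda>x. u x - f x))\<^sup>2 \<le> e"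
        "(ell2_norm (Sigma I X) (\<lambda>x. v x - g x))\<^sup>2 \<le> e"
      using fg unfolding mem_op_closure_iff by blast
    have u: "u \<in> ell2 (Sigma I X)" and v: "v \<in> ell2 (Sigma I X)"
      using fin_direct_sum_subset_ell2[of I S X, OF S] uv by auto
    have "(ell2_norm (X i) (\<lambda>x. u (i, x) - f (i, x)))\<^sup>2 \<le> e"
      "(ell2_norm (X i) (\<lambda>x. v (i, x) - g (i, x)))\<^sup>2 \<le> e"
      using order_trans[OF ell2_norm_component_le[OF ell2_diff[OF u ell2(1)] i] le(1)]
        order_trans[OF ell2_norm_component_le[OF ell2_diff[OF v ell2(2)] i] le(2)] by simp_all
    moreover have "(\<lambda>x. u (i, x), \<lambda>x. v (i, x)) \<in> S i"
      using uv i by (auto simp: fin_direct_sum_def)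
    ultimately show "\<exists>u v. (u, v) \<in> S i \<and> (ell2_norm (X i) (\<lambda>x. u x - f (i, x)))\<^sup>2 \<le> e \<and>
        (ell2_norm (X i) (\<lambda>x. v x - g (i, x)))\<^sup>2 \<le> e"
      by blast
  qed
  then show "p \<in> op_direct_sum I X (\<lambda>i. op_closure (X i) (S i))"
    using ell2 p by (simp add: op_direct_sum_def)
next
  fix p assume "p \<in> op_direct_sum I X (\<lambda>i. op_closure (X i) (S i))"
  then obtain f g where p: "p = (f, g)" and f: "f \<in> ell2 (Sigma I X)" and g: "g \<in> ell2 (Sigma I X)"
    and comp: "\<And>i. i \<in> I \<Longrightarrow> (\<lambda>x. f (i, x), \<lambda>x. g (i, x)) \<in> op_closure (X i) (S i)"
    by (auto simp: op_direct_sum_def)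
  let ?N = "\<lambda>h i. (ell2_norm (X i) (\<lambda>x. h (i, x)))\<^sup>2"
  have "\<exists>u v. (u, v) \<in> fin_direct_sum I S \<and> (ell2_norm (Sigma I X) (\<lambda>x. u x - f x))\<^sup>2 \<le> e \<and>
      (ell2_norm (Sigma I X) (\<lambda>x. v x - g x))\<^sup>2 \<le> e" if e: "0 < e" for e
  proof -
    have sums: "?N f summable_on I" "?N g summable_on I"
      using f g by (simp_all add: ell2_Sigma_iff)
    \<comment> \<open>The same finite set \<open>F\<close> has to serve both members of the pair, so
      the tail of the sum of the two series is made small.\<close>
    then have sum: "(\<lambda>i. ?N f i + ?N g i) summable_on I" by (rule summable_on_add)
    obtain F where F: "finite F" "F \<subseteq> I"
      and tail: "(\<Sum>\<^sub>\<infinity>i\<in>I - F. ?N f i + ?N g i) \<le> e / 2"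
      by (rule summable_on_small_tail[OF sum half_gt_zero[OF e]])
    have sums': "?N f summable_on I - F" "?N g summable_on I - F"
      using sums by (auto intro: summable_on_subset_banach)
    have "infsum (?N f) (I - F) \<le> e / 2" "infsum (?N g) (I - F) \<le> e / 2"
      using tail infsum_add[OF sums'] infsum_nonneg[of "I - F" "?N f"] infsum_nonneg[of "I - F" "?N g"]
      by auto
    note tails = this
    define d where "d = e / (2 * (real (card F) + 1))"
    have "d > 0" using e by (simp add: d_def)
    have "\<exists>q. q \<in> S i \<and> (ell2_norm (X i) (\<lambda>x. fst q x - f (i, x)))\<^sup>2 \<le> d \<and>
        (ell2_norm (X i) (\<lambda>x. snd q x - g (i, x)))\<^sup>2 \<le> d" if "i \<in> F" for i
    proof -
      have "i \<in> I" using that F(2) by blast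
      from comp[OF this] \<open>d > 0\<close> obtain u v where "(u, v) \<in> S i"
        "(ell2_norm (X i) (\<lambda>x. u x - f (i, x)))\<^sup>2 \<le> d" "(ell2_norm (X i) (\<lambda>x. v x - g (i, x)))\<^sup>2 \<le> d"
        unfolding mem_op_closure_iff by blast
      then show ?thesis by (intro exI[of _ "(u, v)"]) simp
    qed
    then have "\<forall>i\<in>F. \<exists>q. q \<in> S i \<and> (ell2_norm (X i) (\<lambda>x. fst q x - f (i, x)))\<^sup>2 \<le> d \<and>
        (ell2_norm (X i) (\<lambda>x. snd q x - g (i, x)))\<^sup>2 \<le> d"
      by blast
    then have "\<exists>q. \<forall>i\<in>F. q i \<in> S i \<and> (ell2_norm (X i) (\<lambda>x. fst (q i) x - f (i, x)))\<^sup>2 \<le> d \<and>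
        (ell2_norm (X i) (\<lambda>x. snd (q i) x - g (i, x)))\<^sup>2 \<le> d"
      by (rule bchoice)
    then obtain q where q: "\<And>i. i \<in> F \<Longrightarrow> q i \<in> S i"
        "\<And>i. i \<in> F \<Longrightarrow> (ell2_norm (X i) (\<lambda>x. fst (q i) x - f (i, x)))\<^sup>2 \<le> d"
        "\<And>i. i \<in> F \<Longrightarrow> (ell2_norm (X i) (\<lambda>x. snd (q i) x - g (i, x)))\<^sup>2 \<le> d"
      by blast
    define u v where "u = (\<lambda>(i, x). if i \<in> F then fst (q i) x else 0)"
      and "v = (\<lambda>(i, x). if i \<in> F then snd (q i) x else 0)"
    have qe: "fst (q i) \<in> ell2 (X i)" "snd (q i) \<in> ell2 (X i)" if i: "i \<in> F" for i
    proof -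
      have "q i \<in> ell2 (X i) \<times> ell2 (X i)" using q(1)[OF i] S F(2) i by blast
      then show "fst (q i) \<in> ell2 (X i)" "snd (q i) \<in> ell2 (X i)"
        by (simp_all add: mem_Times_iff)
    qed
    have "(ell2_norm (Sigma I X) (\<lambda>x. u x - f x))\<^sup>2 \<le> e"
      unfolding u_def
      by (rule ell2_Sigma_truncation[OF f F tails(1) _ _ e]) (use q qe in \<open>auto simp: d_def\<close>)
    moreover have "(ell2_norm (Sigma I X) (\<lambda>x. v x - g x))\<^sup>2 \<le> e"
      unfolding v_def
      by (rule ell2_Sigma_truncation[OF g F tails(2) _ _ e]) (use q qe in \<open>auto simp: d_def\<close>)
    moreover have "(u, v) \<in> fin_direct_sum I S"
    proof -
      have "(\<lambda>x. u (i, x), \<lambda>x. v (i, x)) \<in> S i" if "i \<in> I" for i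
        using q(1)[of i] zero[OF that] by (cases "i \<in> F") (auto simp: u_def v_def)
      moreover have "finite {i. (\<exists>x. u (i, x) \<noteq> 0) \<or> (\<exists>x. v (i, x) \<noteq> 0)}"
        by (rule finite_subset[OF _ F(1)]) (auto simp: u_def v_def split: if_splits)
      ultimately show ?thesis using F(2) by (auto simp: fin_direct_sum_def u_def v_def)
    qed
    ultimately show ?thesis by blast
  qed
  then show "p \<in> op_closure (Sigma I X) (fin_direct_sum I S)"
    using p f g by (simp add: mem_op_closure_iff)
qed

section \<open>Block diagonal unitaries\<close>

lemma bij_betw_snd_levels: "bij_betw snd (SIGMA l:UNIV. {x\<in>X. lx x = l}) X"
  by (rule bij_betwI[of _ _ _ "\<lambda>x. (lx x, x)"]) auto

lemma summable_on_levels_iff: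
  fixes h :: "'a \<Rightarrow> real"
  assumes "\<And>l. finite {x\<in>X. lx x = l}" "\<And>x. 0 \<le> h x"
  shows "h summable_on X \<longleftrightarrow> (\<lambda>l. \<Sum>x\<in>{x\<in>X. lx x = l}. h x) summable_on UNIV"
proof -
  have "h summable_on X \<longleftrightarrow> (\<lambda>p. h (snd p)) summable_on (SIGMA l:UNIV. {x\<in>X. lx x = l})"
    by (rule summable_on_reindex_bij_betw[OF bij_betw_snd_levels, symmetric])
  then show ?thesis
    using assms by (simp add: nonneg_summable_on_Sigma_iff)
qed

lemma infsum_levels:
  fixes h :: "'a \<Rightarrow> 'b::banach"
  assumes fin: "\<And>l. finite {x\<in>X. lx x = l}" and h: "h summable_on X"
  shows "infsum h X = (\<Sum>\<^sub>\<infinity>l. \<Sum>x\<in>{x\<in>X. lx x = l}. h x)"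
proof -
  have "(\<lambda>p. h (snd p)) summable_on (SIGMA l:UNIV. {x\<in>X. lx x = l})"
    using h by (simp add: summable_on_reindex_bij_betw[OF bij_betw_snd_levels])
  from infsum_Sigma_banach[OF this] show ?thesis
    using fin by (simp add: infsum_reindex_bij_betw[OF bij_betw_snd_levels, of h X lx])
qed

text \<open>Only the entries of \<open>P\<close> between equal levels are read. The matrix is thus
  block diagonal, and with finite levels no question of convergence arises.\<close>

definition block_map ::
    "'a set \<Rightarrow> ('a \<Rightarrow> 'l) \<Rightarrow> 'b set \<Rightarrow> ('b \<Rightarrow> 'l) \<Rightarrow> ('b \<Rightarrow> 'a \<Rightarrow> complex) \<Rightarrow>
      ('a \<Rightarrow> complex) \<Rightarrow> 'b \<Rightarrow> complex" where
  "block_map X lx Y ly P f =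
     (\<lambda>y. if y \<in> Y then \<Sum>x\<in>{x\<in>X. lx x = ly y}. P y x * f x else 0)"

lemma block_map_lincomb:
  "block_map X lx Y ly P (\<lambda>x. c * f x + d * g x) =
    (\<lambda>y. c * block_map X lx Y ly P f y + d * block_map X lx Y ly P g y)"
  by (simp add: block_map_def fun_eq_iff sum.distrib sum_distrib_left algebra_simps)

text \<open>A finitely supported function meets finitely many levels, and each of them is finite in
  the target.\<close>

lemma block_map_finsupp:
  assumes fin: "\<And>l. finite {y\<in>Y. ly y = l}" and f: "f \<in> finsupp X"
  shows "block_map X lx Y ly P f \<in> finsupp Y"
proof -
  have "{y. block_map X lx Y ly P f y \<noteq> 0} \<subseteq> (\<Union>x\<in>{x. f x \<noteq> 0}. {y\<in>Y. ly y = lx x})"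
  proof
    fix y assume "y \<in> {y. block_map X lx Y ly P f y \<noteq> 0}"
    then have y: "y \<in> Y" "(\<Sum>x\<in>{x\<in>X. lx x = ly y}. P y x * f x) \<noteq> 0"
      by (auto simp: block_map_def split: if_splits)
    then obtain x where "lx x = ly y" "P y x * f x \<noteq> 0"
      by (auto elim!: sum.not_neutral_contains_not_neutral)
    with y(1) show "y \<in> (\<Union>x\<in>{x. f x \<noteq> 0}. {y\<in>Y. ly y = lx x})" by auto
  qed
  moreover have "finite (\<Union>x\<in>{x. f x \<noteq> 0}. {y\<in>Y. ly y = lx x})"
    using f fin by (auto simp: finsupp_def)
  ultimately have "finite {y. block_map X lx Y ly P f y \<noteq> 0}" by (rule finite_subset)
  then show ?thesis by (simp add: finsupp_def) (simp add: block_map_def)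
qed

text \<open>On every block the adjoint of \<open>P\<close> is a left inverse of \<open>P\<close>.
  Instantiating the locale also for the adjoint, as \<open>block_unitary\<close> does, yields
  surjectivity without comparing dimensions of blocks.\<close>

locale block_isometry =
  fixes X :: "'a set" and lx :: "'a \<Rightarrow> 'l" and Y :: "'b set" and ly :: "'b \<Rightarrow> 'l"
    and P :: "'b \<Rightarrow> 'a \<Rightarrow> complex"
  assumes fin_dom: "finite {x\<in>X. lx x = l}" and fin_cod: "finite {y\<in>Y. ly y = l}"
    and orthonormal: "x \<in> X \<Longrightarrow> x' \<in> X \<Longrightarrow> lx x' = lx x \<Longrightarrow>
      (\<Sum>y\<in>{y\<in>Y. ly y = lx x}. cnj (P y x) * P y x') = of_bool (x = x')"
begin

abbreviation U :: "('a \<Rightarrow> complex) \<Rightarrow> 'b \<Rightarrow> complex" where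
  "U \<equiv> block_map X lx Y ly P"

lemma block_inner:
  "(\<Sum>y\<in>{y\<in>Y. ly y = l}. cnj (U f y) * U g y) = (\<Sum>x\<in>{x\<in>X. lx x = l}. cnj (f x) * g x)"
proof -
  let ?X = "{x\<in>X. lx x = l}" and ?Y = "{y\<in>Y. ly y = l}"
  have "(\<Sum>y\<in>?Y. cnj (U f y) * U g y) =
      (\<Sum>y\<in>?Y. \<Sum>x\<in>?X. \<Sum>x'\<in>?X. cnj (f x) * g x' * (cnj (P y x) * P y x'))"
    by (intro sum.cong refl) (simp add: block_map_def sum_product, simp add: mult_ac)
  also have "\<dots> = (\<Sum>x\<in>?X. \<Sum>y\<in>?Y. \<Sum>x'\<in>?X. cnj (f x) * g x' * (cnj (P y x) * P y x'))"
    by (rule sum.swap)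
  also have "\<dots> = (\<Sum>x\<in>?X. \<Sum>x'\<in>?X. \<Sum>y\<in>?Y. cnj (f x) * g x' * (cnj (P y x) * P y x'))"
    by (intro sum.cong refl sum.swap)
  also have "\<dots> = (\<Sum>x\<in>?X. \<Sum>x'\<in>?X. cnj (f x) * g x' * of_bool (x = x'))"
    using orthonormal by (intro sum.cong refl) (auto simp flip: sum_distrib_left)
  also have "\<dots> = (\<Sum>x\<in>?X. cnj (f x) * g x)"
    using fin_dom by (intro sum.cong refl) (simp add: of_bool_def if_distrib cong: if_cong)
  finally show ?thesis .
qed

lemma block_norm:
  "(\<Sum>y\<in>{y\<in>Y. ly y = l}. (cmod (U f y))\<^sup>2) = (\<Sum>x\<in>{x\<in>X. lx x = l}. (cmod (f x))\<^sup>2)"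
proof -
  have "cnj z * z = complex_of_real ((cmod z)\<^sup>2)" for z
    by (simp add: complex_norm_square mult.commute del: of_real_power)
  then have "complex_of_real (\<Sum>y\<in>{y\<in>Y. ly y = l}. (cmod (U f y))\<^sup>2) =
      complex_of_real (\<Sum>x\<in>{x\<in>X. lx x = l}. (cmod (f x))\<^sup>2)"
    using block_inner[where l = l and f = f and g = f] by (simp del: of_real_power)
  then show ?thesis by (simp only: of_real_eq_iff)
qed

lemma U_ell2: "f \<in> ell2 X \<Longrightarrow> U f \<in> ell2 Y"
  using summable_on_levels_iff[of X lx "\<lambda>x. (cmod (f x))\<^sup>2"]
    summable_on_levels_iff[of Y ly "\<lambda>y. (cmod (U f y))\<^sup>2"] fin_dom fin_cod
  by (simp add: ell2_def block_norm) (simp add: block_map_def)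

lemma U_inner:
  assumes "f \<in> ell2 X" "g \<in> ell2 X"
  shows "ell2_inner Y (U f) (U g) = ell2_inner X f g"
  using infsum_levels[OF fin_dom abs_summable_summable[OF ell2_inner_abs_summable[OF assms]]]
    infsum_levels[OF fin_cod abs_summable_summable[OF ell2_inner_abs_summable[OF assms[THEN U_ell2]]]]
  by (simp add: ell2_inner_def block_inner)

text \<open>A purely algebraic identity on finite blocks, so it serves \<open>ell2\<close> and
  \<open>finsupp\<close> alike.\<close>

lemma block_map_adjoint_U:
  assumes f: "\<And>x. x \<notin> X \<Longrightarrow> f x = 0"
  shows "block_map Y ly X lx (\<lambda>x y. cnj (P y x)) (U f) = f"
proof
  fix x
  show "block_map Y ly X lx (\<lambda>x y. cnj (P y x)) (U f) x = f x"
  proof (cases "x \<in> X")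
    case True
    let ?X = "{x'\<in>X. lx x' = lx x}" and ?Y = "{y\<in>Y. ly y = lx x}"
    have "block_map Y ly X lx (\<lambda>x y. cnj (P y x)) (U f) x =
        (\<Sum>y\<in>?Y. \<Sum>x'\<in>?X. f x' * (cnj (P y x) * P y x'))"
      using True by (simp add: block_map_def sum_distrib_left mult_ac)
    also have "\<dots> = (\<Sum>x'\<in>?X. \<Sum>y\<in>?Y. f x' * (cnj (P y x) * P y x'))"
      by (rule sum.swap)
    also have "\<dots> = (\<Sum>x'\<in>?X. f x' * of_bool (x = x'))"
      using orthonormal True by (intro sum.cong refl) (simp flip: sum_distrib_left)
    also have "\<dots> = f x"
      using fin_dom True by (simp add: of_bool_def if_distrib cong: if_cong)
    finally show ?thesis .
  qed (use f in \<open>simp add: block_map_def\<close>)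
qed

end

locale block_unitary = block_isometry X lx Y ly P +
  adj: block_isometry Y ly X lx "\<lambda>x y. cnj (P y x)"
  for X :: "'a set" and lx :: "'a \<Rightarrow> 'l" and Y :: "'b set" and ly :: "'b \<Rightarrow> 'l" and P
begin

lemma U_adjoint:
  assumes "\<And>y. y \<notin> Y \<Longrightarrow> h y = 0"
  shows "U (adj.U h) = h"
  using adj.block_map_adjoint_U[OF assms] by simp

lemma unitary_U: "unitary X Y U"
  unfolding unitary_def
proof (intro conjI ballI allI)
  show "bij_betw U (ell2 X) (ell2 Y)"
    by (rule bij_betw_byWitness[where f' = adj.U])
      (auto intro!: block_map_adjoint_U U_adjoint U_ell2 adj.U_ell2 simp: ell2_supp)
qed (simp_all add: block_map_lincomb U_inner)

text \<open>The adjoint also preserves finite support, so the preimage of a finitely supported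
  function is finitely supported. This is what lets the cores correspond.\<close>

lemma U_finsupp: "U ` finsupp X = finsupp Y"
proof
  show "U ` finsupp X \<subseteq> finsupp Y"
    using block_map_finsupp fin_cod by blast
  have "h \<in> U ` finsupp X" if "h \<in> finsupp Y" for h
    using U_adjoint[of h] that block_map_finsupp[OF fin_dom that]
    by (auto simp: finsupp_def intro!: image_eqI[of _ _ "adj.U h"])
  then show "finsupp Y \<subseteq> U ` finsupp X" by blast
qed

end

section \<open>The discrete Fourier transform\<close>

text \<open>The characters of the cyclic group of order \<open>n\<close>, unnormalised. Index
  \<open>0\<close> is the constant mode.\<close>

definition dft :: "nat \<Rightarrow> nat \<Rightarrow> nat \<Rightarrow> complex" where
  "dft n a j = cis (2 * pi * real a * real j / real n)"

lemma dft_sym: "dft n a j = dft n j a"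
  by (simp add: dft_def mult_ac)

lemma dft_0 [simp]: "dft n 0 j = 1"
  by (simp add: dft_def)

text \<open>The sum is geometric in an \<open>n\<close>-th root of unity \<open>z\<close>, hence
  zero unless \<open>z = 1\<close>; and \<open>z = 1\<close> would make \<open>n\<close> divide
  \<open>b - a\<close>, impossible for distinct indices below \<open>n\<close>.\<close>

lemma dft_orthogonal:
  assumes "a < n" "b < n"
  shows "(\<Sum>j<n. cnj (dft n a j) * dft n b j) = (if a = b then of_nat n else 0)"
proof -
  define z where "z = cis (2 * pi * (real b - real a) / real n)"
  have "cnj (dft n a j) * dft n b j = z ^ j" for j
  proof -
    have "cnj (dft n a j) * dft n b j =
        cis (- (2 * pi * real a * real j / real n) + 2 * pi * real b * real j / real n)"
      by (simp only: dft_def cis_cnj cis_mult)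
    also have "- (2 * pi * real a * real j / real n) + 2 * pi * real b * real j / real n =
        real j * (2 * pi * (real b - real a) / real n)"
      using assms by (simp add: field_simps)
    also have "cis \<dots> = z ^ j" by (simp only: z_def Complex.DeMoivre)
    finally show ?thesis .
  qed
  then have sum: "(\<Sum>j<n. cnj (dft n a j) * dft n b j) = (\<Sum>j<n. z ^ j)" by simp
  show ?thesis
  proof (cases "a = b")
    case True
    then show ?thesis unfolding sum by (simp add: z_def)
  next
    case False
    have "z ^ n = cis (2 * pi * (real b - real a))"
      unfolding z_def Complex.DeMoivre using assms by simp
    then have "z ^ n = 1" using cis_multiple_2pi[of "real b - real a"] by simp
    moreover have "z \<noteq> 1"
    proof
      assume "z = 1"
      then have "cos (2 * pi * (real b - real a) / real n) = 1"
        by (simp add: z_def complex_eq_iff)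
      then obtain m :: int where "2 * pi * (real b - real a) / real n = of_int m * 2 * pi"
        using cos_one_2pi_int by auto
      then have "2 * pi * (real b - real a) = 2 * pi * (of_int m * real n)"
        using assms by (simp add: field_simps)
      then have "real b - real a = of_int m * real n"
        using mult_left_cancel[of "2 * pi"] by simp
      then have "int b - int a = m * int n"
        by (metis of_int_diff of_int_eq_iff of_int_mult of_int_of_nat_eq)
      moreover have "\<bar>int b - int a\<bar> < int n" using assms by linarith
      ultimately have "m = 0"
        by (cases "m = 0") (auto simp: abs_mult mult_less_cancel_right2)
      with \<open>int b - int a = m * int n\<close> False show False by simp
    qed
    ultimately show ?thesis unfolding sum using False by (simp add: geometric_sum)
  qed
qed

section \<open>The adapted basis\<close>

text \<open>The graph is forgotten: depth and parent carry the structure used from here on.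
  Positivity of \<open>\<kappa>\<close> excludes leaves, so every chain goes on for ever and
  division by \<open>sqrt (\<kappa> l)\<close> is sound.\<close>

locale homogeneous_tree =
  fixes V :: "'v set" and r :: 'v and d :: "'v \<Rightarrow> nat" and par :: "'v \<Rightarrow> 'v" and \<kappa> :: "nat \<Rightarrow> nat"
  assumes root: "r \<in> V"
    and depth_eq_0_iff: "x \<in> V \<Longrightarrow> d x = 0 \<longleftrightarrow> x = r"
    and par: "x \<in> V \<Longrightarrow> x \<noteq> r \<Longrightarrow> par x \<in> V" "x \<in> V \<Longrightarrow> x \<noteq> r \<Longrightarrow> d x = Suc (d (par x))"
    and finite_succs: "x \<in> V \<Longrightarrow> finite {y\<in>V. d y = Suc (d x) \<and> par y = x}"
    and card_succs: "x \<in> V \<Longrightarrow> card {y\<in>V. d y = Suc (d x) \<and> par y = x} = \<kappa> (d x)"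
    and \<kappa>_pos: "0 < \<kappa> l"
begin

abbreviation level :: "nat \<Rightarrow> 'v set" where
  "level l \<equiv> {x\<in>V. d x = l}"

definition succs :: "'v \<Rightarrow> 'v set" where
  "succs x = {y\<in>V. d y = Suc (d x) \<and> par y = x}"

lemma level_0: "level 0 = {r}"
  using root depth_eq_0_iff by auto

lemma succsD: "y \<in> succs x \<Longrightarrow> par y = x"
  by (simp add: succs_def)

lemma par_level: "y \<in> level (Suc l) \<Longrightarrow> par y \<in> level l"
  using par[of y] depth_eq_0_iff[of y] by fastforce

lemma succs_par: "y \<in> level (Suc l) \<Longrightarrow> y \<in> succs (par y)"
  using par_level[of y l] by (simp add: succs_def)

lemma finite_succs': "x \<in> level l \<Longrightarrow> finite (succs x)"
  using finite_succs[of x] by (simp add: succs_def)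

lemma card_succs': "x \<in> level l \<Longrightarrow> card (succs x) = \<kappa> l"
  using card_succs by (auto simp: succs_def)

lemma level_Suc: "level (Suc l) = (\<Union>x\<in>level l. succs x)"
  using par_level succs_par by (fastforce simp: succs_def)

lemma finite_level: "finite (level l)"
proof (induction l)
  case 0
  then show ?case by (simp only: level_0) simp
next
  case (Suc l)
  then show ?case unfolding level_Suc using finite_succs' by blast
qed

lemma sum_level_Suc: "(\<Sum>y\<in>level (Suc l). f y) = (\<Sum>x\<in>level l. \<Sum>y\<in>succs x. f y)"
  unfolding level_Suc using finite_level finite_succs'
  by (intro sum.UNION_disjoint) (auto simp: succs_def)

lemma card_level: "card (level l) = (\<Prod>i<l. \<kappa> i)"
proof (induction l)
  case 0
  then show ?case by (simp only: level_0) simp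
next
  case (Suc l)
  have "card (level (Suc l)) = (\<Sum>x\<in>level l. \<Sum>y\<in>succs x. 1)"
    by (simp only: card_eq_sum sum_level_Suc)
  also have "\<dots> = (\<Sum>x\<in>level l. \<kappa> l)" by (intro sum.cong) (simp_all add: card_succs')
  also have "\<dots> = card (level l) * \<kappa> l" by simp
  finally show ?case using Suc.IH by simp
qed

definition tree_laplacian :: "('v \<Rightarrow> complex) \<Rightarrow> 'v \<Rightarrow> complex" where
  "tree_laplacian f x =
     (if x \<in> V then (if x = r then 0 else f (par x)) + (\<Sum>y\<in>succs x. f y) else 0)"

text \<open>An arbitrary numbering of siblings, which turns Fourier modes into functions on
  \<open>succs x\<close>.\<close>

definition enum :: "'v \<Rightarrow> 'v \<Rightarrow> nat" where
  "enum x = (SOME h. bij_betw h (succs x) {..<\<kappa> (d x)})"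

lemma enum_bij:
  assumes "x \<in> level l"
  shows "bij_betw (enum x) (succs x) {..<\<kappa> l}"
proof -
  have "\<exists>h. bij_betw h (succs x) {..<\<kappa> (d x)}"
    using assms finite_succs' card_succs' by (intro finite_same_card_bij) auto
  then have "bij_betw (enum x) (succs x) {..<\<kappa> (d x)}"
    unfolding enum_def by (rule someI_ex)
  with assms show ?thesis by simp
qed

lemma sum_enum: "x \<in> level l \<Longrightarrow> (\<Sum>y\<in>succs x. g (enum x y)) = (\<Sum>j<\<kappa> l. g j)"
  by (rule sum.reindex_bij_betw[OF enum_bij])

lemma enum_less: "y \<in> level (Suc l) \<Longrightarrow> enum (par y) y < \<kappa> l"
  using bij_betwE[OF enum_bij[OF par_level]] succs_par by blast

end

text \<open>
  \<open>\<rho> i\<close> is the level at which the basis functions of the summand \<open>i\<close> start. The number of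
  summands starting at level \<open>l + 1\<close> is the dimension of the space of functions on that level
  whose sum over the successors of each vertex vanishes.
\<close>

locale graded_tree = homogeneous_tree V r d par \<kappa>
  for V :: "'v set" and r d par \<kappa> +
  fixes I :: "'i set" and \<rho> :: "'i \<Rightarrow> nat"
  assumes start_0: "\<exists>i0. {i\<in>I. \<rho> i = 0} = {i0}"
    and finite_start: "finite {i\<in>I. \<rho> i = Suc l}"
    and card_start: "card {i\<in>I. \<rho> i = Suc l} = card (level l) * (\<kappa> l - 1)"
begin

text \<open>Assigns to each new summand a vertex and a nontrivial mode on its successors. Mode
  \<open>0\<close> is left out because it carries the lifts of the older chains.\<close>

definition label :: "nat \<Rightarrow> 'i \<Rightarrow> 'v \<times> nat" where
  "label l = (SOME h. bij_betw h {i\<in>I. \<rho> i = Suc l} (level l \<times> {1..<\<kappa> l}))"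

lemma label_bij: "bij_betw (label l) {i\<in>I. \<rho> i = Suc l} (level l \<times> {1..<\<kappa> l})"
proof -
  have "\<exists>h. bij_betw h {i\<in>I. \<rho> i = Suc l} (level l \<times> {1..<\<kappa> l})"
    using finite_start finite_level card_start
    by (intro finite_same_card_bij) (auto simp: card_cartesian_product)
  then show ?thesis unfolding label_def by (rule someI_ex)
qed

lemma label:
  assumes "i \<in> I" "\<rho> i = Suc l"
  shows "fst (label l i) \<in> level l" "snd (label l i) \<in> {1..<\<kappa> l}"
  using bij_betwE[OF label_bij, of l] assms by (auto simp: mem_Times_iff)

lemma label_eq_iff:
  assumes "i \<in> I" "\<rho> i = Suc l" "i' \<in> I" "\<rho> i' = Suc l"
  shows "label l i = label l i' \<longleftrightarrow> i = i'"
  using bij_betw_imp_inj_on[OF label_bij, of l] assms by (auto simp: inj_on_def)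

text \<open>
  A new summand starts with a nontrivial Fourier mode on the successors of one vertex; on the
  next levels its basis functions are constant on siblings.
\<close>

definition mode :: "nat \<Rightarrow> 'i \<Rightarrow> nat" where
  "mode l i = (if \<rho> i = Suc l then snd (label l i) else 0)"

primrec basis :: "nat \<Rightarrow> 'i \<Rightarrow> 'v \<Rightarrow> complex" where
  "basis 0 i v = 1"
| "basis (Suc l) i v =
    (if \<rho> i = Suc l then of_bool (par v = fst (label l i)) else basis l i (par v)) *
      dft (\<kappa> l) (mode l i) (enum (par v) v) / of_real (sqrt (real (\<kappa> l)))"

text \<open>The factor of \<open>basis (Suc l) i\<close> that is constant on the successors of
  \<open>u\<close>. It allows starting and continuing chains to be treated together.\<close>

definition weight :: "nat \<Rightarrow> 'i \<Rightarrow> 'v \<Rightarrow> complex" where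
  "weight l i u = (if \<rho> i = Suc l then of_bool (u = fst (label l i)) else basis l i u)"

lemma basis_succ:
  "v \<in> succs u \<Longrightarrow> basis (Suc l) i v =
    weight l i u * dft (\<kappa> l) (mode l i) (enum u v) / of_real (sqrt (real (\<kappa> l)))"
  by (simp add: weight_def succsD)

lemma mode_less: "i \<in> I \<Longrightarrow> mode l i < \<kappa> l"
  using label(2)[of i l] \<kappa>_pos by (auto simp: mode_def)

lemma mode_eq_0_iff: "i \<in> I \<Longrightarrow> mode l i = 0 \<longleftrightarrow> \<rho> i \<noteq> Suc l"
  using label(2)[of i l] by (auto simp: mode_def)

lemma sqrt_\<kappa>: "complex_of_real (sqrt (real (\<kappa> l))) * of_real (sqrt (real (\<kappa> l))) = of_nat (\<kappa> l)"
  by (simp flip: of_real_mult)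

lemma finite_indices: "finite {i\<in>I. \<rho> i \<le> l}"
proof (induction l)
  case 0
  then show ?case using start_0 by auto
next
  case (Suc l)
  have "{i\<in>I. \<rho> i \<le> Suc l} = {i\<in>I. \<rho> i \<le> l} \<union> {i\<in>I. \<rho> i = Suc l}" by auto
  then show ?case using Suc finite_start by simp
qed

text \<open>On each sibling set both functions are a weight times a mode, so orthogonality of modes
  leaves a sum of weights one level below. Two old chains reduce to the induction hypothesis, an old
  and a new one differ in their modes, and two new ones are told apart by their labels. The bounds
  on \<open>\<rho>\<close> matter: below its starting level \<open>basis\<close> takes only
  placeholder values.\<close>

lemma basis_rows:
  assumes "i \<in> I" "i' \<in> I" "\<rho> i \<le> l" "\<rho> i' \<le> l"
  shows "(\<Sum>v\<in>level l. cnj (basis l i v) * basis l i' v) = of_bool (i = i')"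
  using assms(3,4)
proof (induction l)
  case 0
  obtain i0 where "{i\<in>I. \<rho> i = 0} = {i0}" using start_0 by blast
  moreover have "i \<in> {i\<in>I. \<rho> i = 0}" "i' \<in> {i\<in>I. \<rho> i = 0}" using assms(1,2) 0 by auto
  ultimately have "i = i'" by simp
  then show ?case by (simp only: level_0) simp
next
  case (Suc l)
  let ?s = "complex_of_real (sqrt (real (\<kappa> l)))"
  have "(\<Sum>v\<in>succs u. cnj (basis (Suc l) i v) * basis (Suc l) i' v) =
      cnj (weight l i u) * weight l i' u * of_bool (mode l i = mode l i')"
    if u: "u \<in> level l" for u
  proof -
    have "(\<Sum>v\<in>succs u. cnj (basis (Suc l) i v) * basis (Suc l) i' v) =
        (\<Sum>v\<in>succs u. cnj (weight l i u) * weight l i' u / (?s * ?s) *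
          (cnj (dft (\<kappa> l) (mode l i) (enum u v)) * dft (\<kappa> l) (mode l i') (enum u v)))"
      by (intro sum.cong refl) (simp add: basis_succ del: basis.simps)
    also have "\<dots> = cnj (weight l i u) * weight l i' u / (?s * ?s) *
        (\<Sum>j<\<kappa> l. cnj (dft (\<kappa> l) (mode l i) j) * dft (\<kappa> l) (mode l i') j)"
      unfolding sum_distrib_left[symmetric] sum_enum[OF u,
        of "\<lambda>j. cnj (dft (\<kappa> l) (mode l i) j) * dft (\<kappa> l) (mode l i') j"] ..
    also have "\<dots> = cnj (weight l i u) * weight l i' u * of_bool (mode l i = mode l i')"
      unfolding sqrt_\<kappa> using assms(1,2) \<kappa>_pos[of l] by (simp add: dft_orthogonal mode_less)
    finally show ?thesis .
  qed
  then have eq: "(\<Sum>v\<in>level (Suc l). cnj (basis (Suc l) i v) * basis (Suc l) i' v) =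
      (\<Sum>u\<in>level l. cnj (weight l i u) * weight l i' u) * of_bool (mode l i = mode l i')"
    unfolding sum_level_Suc sum_distrib_right by (intro sum.cong) simp_all
  consider "\<rho> i \<le> l" "\<rho> i' \<le> l" | "\<rho> i = Suc l" "\<rho> i' \<noteq> Suc l" | "\<rho> i \<noteq> Suc l" "\<rho> i' = Suc l"
    | "\<rho> i = Suc l" "\<rho> i' = Suc l"
    using Suc.prems by linarith
  then show ?case
  proof cases
    case 1
    then show ?thesis unfolding eq using Suc.IH by (simp add: weight_def mode_def)
  next
    case 2
    then have "mode l i \<noteq> mode l i'" using mode_eq_0_iff[of _ l] assms(1,2) by metis
    then show ?thesis unfolding eq using 2 by auto
  next
    case 3
    then have "mode l i \<noteq> mode l i'" using mode_eq_0_iff[of _ l] assms(1,2) by metis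
    then show ?thesis unfolding eq using 3 by auto
  next
    case 4
    have "(\<Sum>u\<in>level l. cnj (weight l i u) * weight l i' u) =
        (\<Sum>u\<in>level l. if u = fst (label l i) then of_bool (fst (label l i) = fst (label l i')) else 0)"
      using 4 by (intro sum.cong refl) (auto simp: weight_def)
    also have "\<dots> = of_bool (fst (label l i) = fst (label l i'))"
      using finite_level label(1)[OF assms(1) 4(1)] by simp
    finally show ?thesis
      unfolding eq using 4 label_eq_iff[OF assms(1) 4(1) assms(2) 4(2)]
      by (auto simp: mode_def prod_eq_iff)
  qed
qed

text \<open>Completeness of the chains. Old chains supply mode \<open>0\<close> for equal parents by
  induction, new ones supply all other modes at a common parent; together they form a full Fourier
  sum. Symmetry of \<open>dft\<close> turns it into the orthogonality relation for the numbers of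
  \<open>v\<close> and \<open>w\<close>.\<close>

lemma basis_columns:
  assumes "v \<in> level l" "w \<in> level l"
  shows "(\<Sum>i\<in>{i\<in>I. \<rho> i \<le> l}. cnj (basis l i v) * basis l i w) = of_bool (v = w)"
  using assms
proof (induction l arbitrary: v w)
  case 0
  then have "v = w" using level_0 by auto
  moreover obtain i0 where "{i\<in>I. \<rho> i \<le> 0} = {i0}" using start_0 by auto
  ultimately show ?case by simp
next
  case (Suc l)
  let ?s = "complex_of_real (sqrt (real (\<kappa> l)))"
  let ?D = "\<lambda>a. cnj (dft (\<kappa> l) a (enum (par v) v)) * dft (\<kappa> l) a (enum (par w) w)"
  let ?b = "\<lambda>i. cnj (basis (Suc l) i v) * basis (Suc l) i w"
  have pl: "par v \<in> level l" "par w \<in> level l" using Suc.prems par_level by blast+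
  have split: "{i\<in>I. \<rho> i \<le> Suc l} = {i\<in>I. \<rho> i \<le> l} \<union> {i\<in>I. \<rho> i = Suc l}" by auto
  have "sum ?b {i\<in>I. \<rho> i \<le> l} =
      (\<Sum>i\<in>{i\<in>I. \<rho> i \<le> l}. cnj (basis l i (par v)) * basis l i (par w)) / (?s * ?s)"
    unfolding sum_divide_distrib by (intro sum.cong refl) (auto simp: mode_def)
  \<comment> \<open>\<open>?D 0\<close> equals 1; it is written out so that the old chains appear as
    the missing term \<open>a = 0\<close> of the sum over modes.\<close>
  also have "\<dots> = of_bool (par v = par w) * ?D 0 / (?s * ?s)"
    using Suc.IH[OF pl] by simp
  finally have old: "sum ?b {i\<in>I. \<rho> i \<le> l} = of_bool (par v = par w) * ?D 0 / (?s * ?s)" .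
  have "sum ?b {i\<in>I. \<rho> i = Suc l} = (\<Sum>i\<in>{i\<in>I. \<rho> i = Suc l}.
      (\<lambda>(x, a). of_bool (par v = x) * of_bool (par w = x) * ?D a / (?s * ?s)) (label l i))"
    by (intro sum.cong refl) (auto simp: mode_def split_beta)
  also have "\<dots> = (\<Sum>(x, a)\<in>level l \<times> {1..<\<kappa> l}.
      of_bool (par v = x) * of_bool (par w = x) * ?D a / (?s * ?s))"
    by (rule sum.reindex_bij_betw[OF label_bij])
  also have "\<dots> = (\<Sum>x\<in>level l. \<Sum>a\<in>{1..<\<kappa> l}.
      of_bool (par v = x) * of_bool (par w = x) * ?D a / (?s * ?s))"
    by (rule sum.cartesian_product[symmetric])
  also have "\<dots> = (\<Sum>x\<in>level l. if x = par v then
      (\<Sum>a\<in>{1..<\<kappa> l}. of_bool (par v = par w) * ?D a / (?s * ?s)) else 0)"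
    by (intro sum.cong refl) auto
  also have "\<dots> = (\<Sum>a\<in>{1..<\<kappa> l}. of_bool (par v = par w) * ?D a / (?s * ?s))"
    using finite_level pl by simp
  finally have new: "sum ?b {i\<in>I. \<rho> i = Suc l} =
      (\<Sum>a\<in>{1..<\<kappa> l}. of_bool (par v = par w) * ?D a / (?s * ?s))" .
  have ins: "{..<\<kappa> l} = insert 0 {1..<\<kappa> l}" using \<kappa>_pos[of l] by auto
  have "sum ?b {i\<in>I. \<rho> i \<le> Suc l} = sum ?b {i\<in>I. \<rho> i \<le> l} + sum ?b {i\<in>I. \<rho> i = Suc l}"
    unfolding split using finite_indices finite_start by (intro sum.union_disjoint) auto
  also have "\<dots> = (\<Sum>a<\<kappa> l. of_bool (par v = par w) * ?D a / (?s * ?s))"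
    unfolding old new ins by (subst sum.insert) simp_all
  also have "\<dots> = of_bool (par v = par w) / (?s * ?s) *
      (\<Sum>a<\<kappa> l. cnj (dft (\<kappa> l) (enum (par v) v) a) * dft (\<kappa> l) (enum (par w) w) a)"
    unfolding sum_distrib_left by (intro sum.cong refl) (simp add: dft_sym[of "\<kappa> l"])
  also have "\<dots> = of_bool (par v = par w \<and> enum (par v) v = enum (par w) w)"
    unfolding sqrt_\<kappa> using enum_less[OF Suc.prems(1)] enum_less[OF Suc.prems(2)] \<kappa>_pos[of l]
    by (simp add: dft_orthogonal)
  also have "par v = par w \<and> enum (par v) v = enum (par w) w \<longleftrightarrow> v = w"
    using bij_betw_imp_inj_on[OF enum_bij[OF pl(1)]] succs_par[OF Suc.prems(1)]
      succs_par[OF Suc.prems(2)] by (metis inj_onD)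
  finally show ?case .
qed

text \<open>Positions in a chain count from \<open>1\<close>, so position \<open>1\<close> sits on
  the starting level \<open>\<rho> i\<close>.\<close>

abbreviation index_level :: "'i \<times> nat \<Rightarrow> nat" where
  "index_level \<equiv> \<lambda>(i, j). \<rho> i + j - 1"

text \<open>There is no conjugation: \<open>U f\<close> lists the coefficients of \<open>f\<close>
  along the conjugates of the basis functions, which are an orthonormal basis as well.\<close>

abbreviation basis_matrix :: "'i \<times> nat \<Rightarrow> 'v \<Rightarrow> complex" where
  "basis_matrix \<equiv> \<lambda>(i, j) v. basis (\<rho> i + j - 1) i v"

lemma index_level_bij:
  "bij_betw (\<lambda>i. (i, Suc l - \<rho> i)) {i\<in>I. \<rho> i \<le> l} {y \<in> I \<times> {1..}. index_level y = l}"
  by (rule bij_betwI[of _ _ _ fst]) auto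

text \<open>\<open>basis_columns\<close> makes \<open>U\<close> isometric, \<open>basis_rows\<close>
  does so for its adjoint.\<close>

sublocale block_unitary V d "I \<times> {1..}" index_level basis_matrix
proof unfold_locales
  show "finite {x\<in>V. d x = l}" for l by (rule finite_level)
  show "finite {y \<in> I \<times> {1..}. index_level y = l}" for l
    using finite_indices bij_betw_finite[OF index_level_bij] by blast
  fix v w assume vw: "v \<in> V" "w \<in> V" "d w = d v"
  have "(\<Sum>y\<in>{y \<in> I \<times> {1..}. index_level y = d v}. cnj (basis_matrix y v) * basis_matrix y w) =
      (\<Sum>i\<in>{i\<in>I. \<rho> i \<le> d v}. cnj (basis (d v) i v) * basis (d v) i w)"
    by (subst sum.reindex_bij_betw[OF index_level_bij, symmetric]) (auto intro!: sum.cong)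
  then show "(\<Sum>y\<in>{y \<in> I \<times> {1..}. index_level y = d v}. cnj (basis_matrix y v) * basis_matrix y w) =
      of_bool (v = w)"
    using basis_columns[of v "d v" w] vw by simp
next
  fix y y' :: "'i \<times> nat"
  assume y: "y \<in> I \<times> {1..}" "y' \<in> I \<times> {1..}" "index_level y' = index_level y"
  obtain i j i' j' where ij: "y = (i, j)" "y' = (i', j')" by (cases y; cases y')
  have "(\<Sum>v\<in>level (index_level y). cnj (cnj (basis_matrix y v)) * cnj (basis_matrix y' v)) =
      cnj (\<Sum>v\<in>level (index_level y). cnj (basis (index_level y) i v) * basis (index_level y) i' v)"
    using y(3) ij by simp
  also have "\<dots> = of_bool (i = i')"
    using y ij by (subst basis_rows) auto
  also have "i = i' \<longleftrightarrow> y = y'" using y ij by auto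
  finally show "(\<Sum>v\<in>level (index_level y). cnj (cnj (basis_matrix y v)) * cnj (basis_matrix y' v)) =
      of_bool (y = y')" .
qed

text \<open>Both parts of the Laplacian are moved onto the basis function. The successor sum meets
  \<open>basis l i\<close>, which is \<open>sqrt (\<kappa> l)\<close> times its lift; the parent
  term, grouped by siblings, leaves the sum of a mode over its siblings, which vanishes exactly at
  the start of a chain.\<close>

lemma U_tree_laplacian:
  assumes i: "i \<in> I" and j: "1 \<le> j"
  shows "U (tree_laplacian f) (i, j) =
    of_real (sqrt (real (\<kappa> (\<rho> i + j - 1)))) * U f (i, j + 1) +
    (if j = 1 then 0 else of_real (sqrt (real (\<kappa> (\<rho> i + j - 2)))) * U f (i, j - 1))"
proof -
  define l where "l = \<rho> i + j - 1"
  let ?s = "\<lambda>l. complex_of_real (sqrt (real (\<kappa> l)))"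
  have s: "?s l \<noteq> 0" for l using \<kappa>_pos[of l] by simp
  have U: "U h (i, Suc m - \<rho> i) = (\<Sum>v\<in>level m. basis m i v * h v)" if "\<rho> i \<le> m" for h m
    using that i by (simp add: block_map_def)
  have jl: "j = Suc l - \<rho> i" "\<rho> i \<le> l" using j by (auto simp: l_def)
  have "U (tree_laplacian f) (i, j) =
      (\<Sum>v\<in>level l. basis l i v * (if v = r then 0 else f (par v))) +
      (\<Sum>v\<in>level l. basis l i v * (\<Sum>y\<in>succs v. f y))"
    unfolding jl(1) U[OF jl(2)] tree_laplacian_def by (simp add: distrib_left sum.distrib)
  also have "(\<Sum>v\<in>level l. basis l i v * (\<Sum>y\<in>succs v. f y)) =
      (\<Sum>v\<in>level l. \<Sum>y\<in>succs v. ?s l * (basis (Suc l) i y * f y))"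
    unfolding sum_distrib_left using jl(2) s[of l] \<kappa>_pos[of l]
    by (intro sum.cong refl) (simp add: succsD mode_def)
  also have "\<dots> = ?s l * U f (i, j + 1)"
    using U[of "Suc l"] jl unfolding sum_level_Suc[symmetric] sum_distrib_left[symmetric]
    by (simp add: Suc_diff_le del: basis.simps)
  also have "(\<Sum>v\<in>level l. basis l i v * (if v = r then 0 else f (par v))) =
      (if j = 1 then 0 else ?s (l - 1) * U f (i, j - 1))"
  proof (cases l)
    \<comment> \<open>Level \<open>0\<close> is the root alone, and \<open>j = 1\<close> there, so
      both sides vanish.\<close>
    case 0
    then show ?thesis using jl by (simp add: level_0[simplified])
  next
    case (Suc m)
    have "(\<Sum>v\<in>level l. basis l i v * (if v = r then 0 else f (par v))) =
        (\<Sum>v\<in>level (Suc m). basis (Suc m) i v * f (par v))"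
      using Suc depth_eq_0_iff[OF root] by (intro sum.cong) auto
    also have "\<dots> = (\<Sum>u\<in>level m. \<Sum>v\<in>succs u. basis (Suc m) i v * f (par v))"
      by (rule sum_level_Suc)
    also have "\<dots> = (\<Sum>u\<in>level m. if j = 1 then 0 else ?s m * (basis m i u * f u))"
    proof (rule sum.cong[OF refl])
      fix u assume u: "u \<in> level m"
      have "(\<Sum>v\<in>succs u. basis (Suc m) i v * f (par v)) =
          (\<Sum>v\<in>succs u. weight m i u * f u / ?s m * dft (\<kappa> m) (mode m i) (enum u v))"
        by (intro sum.cong refl) (simp add: basis_succ succsD del: basis.simps)
      also have "\<dots> = weight m i u * f u / ?s m * (\<Sum>j<\<kappa> m. dft (\<kappa> m) (mode m i) j)"
        unfolding sum_distrib_left[symmetric] sum_enum[OF u, of "dft (\<kappa> m) (mode m i)"] ..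
      \<comment> \<open>Summing a mode is pairing it with the constant mode
        \<open>0\<close>.\<close>
      also have "(\<Sum>j<\<kappa> m. dft (\<kappa> m) (mode m i) j) = (if 0 = mode m i then ?s m * ?s m else 0)"
        unfolding sqrt_\<kappa> using dft_orthogonal[of 0 "\<kappa> m" "mode m i"] \<kappa>_pos[of m] mode_less[OF i, of m]
        by simp
      also have "0 = mode m i \<longleftrightarrow> j \<noteq> 1" using mode_eq_0_iff[OF i, of m] jl Suc by auto
      finally show "(\<Sum>v\<in>succs u. basis (Suc m) i v * f (par v)) =
          (if j = 1 then 0 else ?s m * (basis m i u * f u))"
        using s[of m] jl Suc by (auto simp: weight_def)
    qed
    also have "\<dots> = (if j = 1 then 0 else ?s (l - 1) * U f (i, j - 1))"
      using U[of m f] jl Suc by (auto simp: Suc_diff_le sum_distrib_left)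
    finally show ?thesis .
  qed
  finally have "U (tree_laplacian f) (i, j) =
      ?s l * U f (i, j + 1) + (if j = 1 then 0 else ?s (l - 1) * U f (i, j - 1))"
    by (simp only: add.commute)
  moreover have "\<rho> i + j - 2 = l - 1" by (simp add: l_def)
  ultimately show ?thesis by (simp only: l_def)
qed

end

section \<open>Jacobi matrices and the correspondence of cores\<close>

lemma jacobi_action_eq:
  assumes f: "f \<in> finsupp {1..}" and i: "1 \<le> i"
  shows "jacobi_action a (\<lambda>_. 0) f i =
    of_real (a i) * f (i + 1) + (if i = 1 then 0 else of_real (a (i - 1)) * f (i - 1))"
proof -
  have f0: "f 0 = 0" using f by (simp add: finsupp_def)
  have "jacobi_action a (\<lambda>_. 0) f i =
      (\<Sum>j\<in>{j. f j \<noteq> 0}. of_real (jacobi_entry a (\<lambda>_. 0) i j) * f j)"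
    using i by (simp add: jacobi_action_def)
  \<comment> \<open>For \<open>i = 1\<close> the second index is \<open>0\<close>, which lies
    outside \<open>{1..}\<close> and contributes nothing since \<open>f 0 = 0\<close>.\<close>
  also have "\<dots> = (\<Sum>j\<in>{i + 1, i - 1}. of_real (jacobi_entry a (\<lambda>_. 0) i j) * f j)"
    using f i by (intro sum.mono_neutral_cong) (auto simp: jacobi_entry_def finsupp_def)
  also have "\<dots> = of_real (a i) * f (i + 1) + of_real (a (i - 1)) * f (i - 1)"
    using i by (cases i) (auto simp: jacobi_entry_def)
  finally show ?thesis using f0 by auto
qed

context graded_tree
begin

lemma tree_laplacian_finsupp:
  assumes f: "f \<in> finsupp V"
  shows "tree_laplacian f \<in> finsupp V"
proof -
  have "{x. tree_laplacian f x \<noteq> 0} \<subseteq> (\<Union>u\<in>{u. f u \<noteq> 0}. insert (par u) (succs u))"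
  proof
    fix x assume "x \<in> {x. tree_laplacian f x \<noteq> 0}"
    then have x: "x \<in> V" and nz: "(if x = r then 0 else f (par x)) + (\<Sum>y\<in>succs x. f y) \<noteq> 0"
      by (auto simp: tree_laplacian_def split: if_splits)
    show "x \<in> (\<Union>u\<in>{u. f u \<noteq> 0}. insert (par u) (succs u))"
    proof (cases "(\<Sum>y\<in>succs x. f y) = 0")
      case True
      then have "x \<noteq> r" "f (par x) \<noteq> 0" using nz by (auto split: if_splits)
      moreover have "x \<in> succs (par x)" using x par \<open>x \<noteq> r\<close> by (simp add: succs_def)
      ultimately show ?thesis by auto
    next
      case False
      then obtain y where "y \<in> succs x" "f y \<noteq> 0"
        by (auto elim: sum.not_neutral_contains_not_neutral)
      then show ?thesis using succsD by blast
    qed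
  qed
  moreover have "finite (\<Union>u\<in>{u. f u \<noteq> 0}. insert (par u) (succs u))"
    using f finite_succs by (auto simp: finsupp_def succs_def)
  ultimately have "finite {x. tree_laplacian f x \<noteq> 0}" by (rule finite_subset)
  then show ?thesis by (simp add: finsupp_def) (simp add: tree_laplacian_def)
qed

lemma U_tree_laplacian_jacobi:
  assumes a: "\<And>i j. i \<in> I \<Longrightarrow> 1 \<le> j \<Longrightarrow> a i j = sqrt (real (\<kappa> (\<rho> i + j - 1)))"
    and i: "i \<in> I" and h: "(\<lambda>j. U f (i, j)) \<in> finsupp {1..}"
  shows "(\<lambda>j. U (tree_laplacian f) (i, j)) = jacobi_action (a i) (\<lambda>_. 0) (\<lambda>j. U f (i, j))"
proof
  fix j
  show "U (tree_laplacian f) (i, j) = jacobi_action (a i) (\<lambda>_. 0) (\<lambda>j. U f (i, j)) j"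
  proof (cases "1 \<le> j")
    case True
    have "a i (j - 1) = sqrt (real (\<kappa> (\<rho> i + j - 2)))" if "j \<noteq> 1"
    proof -
      have "\<rho> i + (j - 1) - 1 = \<rho> i + j - 2" using True that by simp
      then show ?thesis using a[OF i, of "j - 1"] True that by simp
    qed
    then show ?thesis
      using U_tree_laplacian[OF i True, of f] jacobi_action_eq[OF h True, of "a i"] a[OF i True]
      by simp
  next
    case False
    then show ?thesis by (simp add: block_map_def jacobi_action_def)
  qed
qed

text \<open>The inclusion from right to left uses that \<open>U\<close> maps onto the finitely
  supported functions; on each summand the second member of a pair is then forced by the
  first.\<close>

lemma image_laplacian_core:
  assumes a: "\<And>i j. i \<in> I \<Longrightarrow> 1 \<le> j \<Longrightarrow> a i j = sqrt (real (\<kappa> (\<rho> i + j - 1)))"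
  shows "(\<lambda>(f, g). (U f, U g)) ` {(f, tree_laplacian f) | f. f \<in> finsupp V} =
    fin_direct_sum I (\<lambda>i. {(h, jacobi_action (a i) (\<lambda>_. 0) h) | h. h \<in> finsupp {1..}})"
    (is "_ = fin_direct_sum I ?S")
proof (intro equalityI subsetI)
  fix p assume "p \<in> (\<lambda>(f, g). (U f, U g)) ` {(f, tree_laplacian f) | f. f \<in> finsupp V}"
  then obtain f where f: "f \<in> finsupp V" and p: "p = (U f, U (tree_laplacian f))" by auto
  have Uf: "U f \<in> finsupp (I \<times> {1..})" "U (tree_laplacian f) \<in> finsupp (I \<times> {1..})"
    using U_finsupp f tree_laplacian_finsupp[OF f] by blast+
  have comp: "(\<lambda>j. U f (i, j)) \<in> finsupp {1..}" for i
  proof -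
    have "finite (snd ` {y. U f y \<noteq> 0})" using Uf(1) by (simp add: finsupp_def)
    then have "finite {j. U f (i, j) \<noteq> 0}" by (rule rev_finite_subset) force
    then show ?thesis using Uf(1) by (simp add: finsupp_def)
  qed
  have "(\<lambda>j. U f (i, j), \<lambda>j. U (tree_laplacian f) (i, j)) \<in> ?S i" if "i \<in> I" for i
    using U_tree_laplacian_jacobi[OF a that comp] comp by blast
  moreover have "finite {i. (\<exists>j. U f (i, j) \<noteq> 0) \<or> (\<exists>j. U (tree_laplacian f) (i, j) \<noteq> 0)}"
  proof (rule finite_subset)
    show "finite (fst ` ({y. U f y \<noteq> 0} \<union> {y. U (tree_laplacian f) y \<noteq> 0}))"
      using Uf by (simp add: finsupp_def)
  qed force
  ultimately show "p \<in> fin_direct_sum I ?S"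
    using Uf unfolding p by (simp add: fin_direct_sum_def finsupp_def)
next
  fix p assume "p \<in> fin_direct_sum I ?S"
  then obtain h g where p: "p = (h, g)" and hg: "(h, g) \<in> fin_direct_sum I ?S" by (cases p) auto
  have comp: "(\<lambda>j. h (i, j)) \<in> finsupp {1..}" "(\<lambda>j. g (i, j)) = jacobi_action (a i) (\<lambda>_. 0) (\<lambda>j. h (i, j))"
    if "i \<in> I" for i
    using hg that by (auto simp: fin_direct_sum_def)
  have out: "h (i, j) = 0" "g (i, j) = 0" if "i \<notin> I" for i j
    using hg that by (auto simp: fin_direct_sum_def)
  have "{y. h y \<noteq> 0} \<subseteq> (SIGMA i:{i. \<exists>j. h (i, j) \<noteq> 0}. {j. h (i, j) \<noteq> 0})" by auto
  moreover have "finite (SIGMA i:{i. \<exists>j. h (i, j) \<noteq> 0}. {j. h (i, j) \<noteq> 0})"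
  proof (rule finite_SigmaI)
    have "finite {i. (\<exists>j. h (i, j) \<noteq> 0) \<or> (\<exists>j. g (i, j) \<noteq> 0)}"
      using hg by (auto simp: fin_direct_sum_def)
    then show "finite {i. \<exists>j. h (i, j) \<noteq> 0}" by (rule rev_finite_subset) auto
    show "finite {j. h (i, j) \<noteq> 0}" if "i \<in> {i. \<exists>j. h (i, j) \<noteq> 0}" for i
      using comp(1)[of i] out(1)[of i] by (cases "i \<in> I") (auto simp: finsupp_def)
  qed
  ultimately have "finite {y. h y \<noteq> 0}" by (rule finite_subset)
  moreover have "h y = 0" if "y \<notin> I \<times> {1..}" for y
    using that comp(1)[of "fst y"] out(1) by (cases y) (auto simp: finsupp_def)
  ultimately have "h \<in> finsupp (I \<times> {1..})" by (simp add: finsupp_def)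
  then obtain f where f: "f \<in> finsupp V" "h = U f" using U_finsupp by blast
  have "g (i, j) = U (tree_laplacian f) (i, j)" for i j
  proof (cases "i \<in> I")
    case True
    have "(\<lambda>j. U f (i, j)) \<in> finsupp {1..}" using comp(1)[OF True] f(2) by simp
    with a True have "(\<lambda>j. U (tree_laplacian f) (i, j)) =
        jacobi_action (a i) (\<lambda>_. 0) (\<lambda>j. U f (i, j))"
      by (rule U_tree_laplacian_jacobi)
    then have "(\<lambda>j. U (tree_laplacian f) (i, j)) = (\<lambda>j. g (i, j))"
      unfolding comp(2)[OF True] f(2) .
    from fun_cong[OF this] show ?thesis by (rule sym)
  next
    case False
    then show ?thesis using out(2) by (simp add: block_map_def)
  qed
  then have "g = U (tree_laplacian f)" by auto
  with p f show "p \<in> (\<lambda>(f, g). (U f, U g)) ` {(f, tree_laplacian f) | f. f \<in> finsupp V}"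
    by force
qed

text \<open>The entry \<open>a i j\<close> couples positions \<open>j\<close> and
  \<open>j + 1\<close> of chain \<open>i\<close>, that is level \<open>\<rho> i + j - 1\<close> and
  the next one, hence the branching number of the former.\<close>

theorem unitarily_equivalent_direct_sum:
  assumes a: "\<And>i j. i \<in> I \<Longrightarrow> 1 \<le> j \<Longrightarrow> a i j = sqrt (real (\<kappa> (\<rho> i + j - 1)))"
  shows "unitarily_equivalent V (op_closure V {(f, tree_laplacian f) | f. f \<in> finsupp V})
    (I \<times> {1..}) (op_direct_sum I (\<lambda>_. {1..}) (\<lambda>i. jacobi (a i) (\<lambda>_. 0)))"
proof -
  let ?S = "\<lambda>i. {(h, jacobi_action (a i) (\<lambda>_. 0) h) | h. h \<in> finsupp {1..}}"
  have "jacobi_action b (\<lambda>_. 0) h \<in> finsupp {1..}" if h: "h \<in> finsupp {1..}" for b h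
  proof -
    have "{j. jacobi_action b (\<lambda>_. 0) h j \<noteq> 0} \<subseteq> (\<lambda>j. j - 1) ` {j. h j \<noteq> 0} \<union> Suc ` {j. h j \<noteq> 0}"
    proof
      fix j assume nz: "j \<in> {j. jacobi_action b (\<lambda>_. 0) h j \<noteq> 0}"
      then have j: "1 \<le> j" by (cases j) (auto simp: jacobi_action_def)
      have "h (j + 1) \<noteq> 0 \<or> h (j - 1) \<noteq> 0"
        using nz jacobi_action_eq[OF h j, of b] by (auto split: if_splits)
      moreover have "j = (j + 1) - 1" "j = Suc (j - 1)" using j by auto
      ultimately show "j \<in> (\<lambda>j. j - 1) ` {j. h j \<noteq> 0} \<union> Suc ` {j. h j \<noteq> 0}" by blast
    qed
    moreover have "finite ((\<lambda>j. j - 1) ` {j. h j \<noteq> 0} \<union> Suc ` {j. h j \<noteq> 0})"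
      using h by (simp add: finsupp_def)
    ultimately have "finite {j. jacobi_action b (\<lambda>_. 0) h j \<noteq> 0}" by (rule finite_subset)
    then show ?thesis by (simp add: finsupp_def) (simp add: jacobi_action_def)
  qed
  then have S: "?S i \<subseteq> ell2 {1..} \<times> ell2 {1..}" for i
    using finsupp_subset_ell2 by blast
  have zero: "(\<lambda>_. 0, \<lambda>_. 0) \<in> ?S i" for i
  proof -
    have "jacobi_action (a i) (\<lambda>_. 0) (\<lambda>_. 0) = (\<lambda>_. 0)" by (simp add: jacobi_action_def fun_eq_iff)
    then show ?thesis by (auto simp: finsupp_def intro!: exI[of _ "\<lambda>_. 0"])
  qed
  have "{(f, tree_laplacian f) | f. f \<in> finsupp V} \<subseteq> ell2 V \<times> ell2 V"
    using tree_laplacian_finsupp finsupp_subset_ell2 by blast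
  from unitary_image_op_closure[OF unitary_U this]
  have "(\<lambda>(f, g). (U f, U g)) ` op_closure V {(f, tree_laplacian f) | f. f \<in> finsupp V} =
      op_closure (I \<times> {1..}) (fin_direct_sum I ?S)"
    by (simp only: image_laplacian_core[OF a])
  also have "\<dots> = op_direct_sum I (\<lambda>_. {1..}) (\<lambda>i. op_closure {1..} (?S i))"
    by (rule op_closure_fin_direct_sum[OF S zero])
  finally have "(\<lambda>(f, g). (U f, U g)) ` op_closure V {(f, tree_laplacian f) | f. f \<in> finsupp V} =
      op_direct_sum I (\<lambda>_. {1..}) (\<lambda>i. op_closure {1..} (?S i))" .
  then show ?thesis
    unfolding unitarily_equivalent_def jacobi_def
    by (intro exI[of _ U] conjI unitary_U) (rule sym)
qed

end

section \<open>The decomposition of the Laplacian\<close>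

lemma strict_mono_SH_R:
  assumes "strict_mono_on {1..} L"
  shows "strict_mono (SH_R L)"
  using assms by (auto simp: strict_mono_def strict_mono_on_def SH_R_def)

text \<open>The factored form matches \<open>card_start\<close>: vertices on level
  \<open>L n\<close> times nontrivial modes per vertex.\<close>

lemma SH_M_eq: "1 \<le> n \<Longrightarrow> SH_M k n = (\<Prod>j=1..n-1. k j) * (k n - 1)"
proof -
  assume n: "1 \<le> n"
  then have "(\<Prod>j=1..n. k j) = (\<Prod>j=1..n-1. k j) * k n"
    by (cases n) simp_all
  then show ?thesis using n by (auto simp: SH_M_def diff_mult_distrib2)
qed

text \<open>Below level \<open>L n\<close> only the levels \<open>L 1\<close>, ...,
  \<open>L (n - 1)\<close> contribute factors other than 1. With \<open>card_level\<close> this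
  counts the vertices on level \<open>L n\<close>.\<close>

lemma prod_branching:
  fixes L k \<kappa> :: "nat \<Rightarrow> nat"
  assumes L: "strict_mono_on {1..} L" and k: "\<And>n. 1 \<le> n \<Longrightarrow> \<kappa> (L n) = k n"
    and 1: "\<And>j. (\<And>n. 1 \<le> n \<Longrightarrow> j \<noteq> L n) \<Longrightarrow> \<kappa> j = 1" and n: "1 \<le> n"
  shows "(\<Prod>i<L n. \<kappa> i) = (\<Prod>j=1..n-1. k j)"
proof -
  have less_iff: "L m < L n \<longleftrightarrow> m < n" if "1 \<le> m" for m
    using strict_mono_on_less[OF L] that n by simp
  have "(\<Prod>j=1..n-1. k j) = (\<Prod>j=1..n-1. \<kappa> (L j))" by (intro prod.cong) (auto simp: k)
  also have "\<dots> = prod \<kappa> (L ` {1..n-1})"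
    using inj_on_subset[OF strict_mono_on_imp_inj_on[OF L], of "{1..n-1}"]
    by (subst prod.reindex) auto
  also have "\<dots> = prod \<kappa> {..<L n}"
  proof (rule prod.mono_neutral_left)
    show "L ` {1..n-1} \<subseteq> {..<L n}" using less_iff n by auto
    show "\<forall>i\<in>{..<L n} - L ` {1..n-1}. \<kappa> i = 1"
    proof
      fix i assume i: "i \<in> {..<L n} - L ` {1..n-1}"
      have "i \<noteq> L m" if "1 \<le> m" for m using i that less_iff[OF that] n by auto
      then show "\<kappa> i = 1" by (rule 1)
    qed
  qed simp
  finally show ?thesis ..
qed

text \<open>Since \<open>SH_R L m = L m + 1\<close> for positive \<open>m\<close>, the condition
  \<open>j = SH_R L m - SH_R L n\<close> says that level \<open>SH_R L n + j - 1\<close> is the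
  branching level \<open>L m\<close>. Injectivity of \<open>SH_R L\<close> identifies the
  \<open>THE\<close> in \<open>SH_a\<close>.\<close>

lemma SH_a_eq:
  fixes L k \<kappa> :: "nat \<Rightarrow> nat"
  assumes L: "strict_mono_on {1..} L" and k: "\<And>n. 1 \<le> n \<Longrightarrow> \<kappa> (L n) = k n"
    and 1: "\<And>j. (\<And>n. 1 \<le> n \<Longrightarrow> j \<noteq> L n) \<Longrightarrow> \<kappa> j = 1" and j: "1 \<le> j"
  shows "SH_a L k n j = sqrt (real (\<kappa> (SH_R L n + j - 1)))"
proof -
  note R = strict_mono_less[OF strict_mono_SH_R[OF L]] strict_mono_eq[OF strict_mono_SH_R[OF L]]
  have iff: "m > n \<and> j = SH_R L m - SH_R L n \<longleftrightarrow> SH_R L m = SH_R L n + j" for m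
    using R(1)[of n m] j by auto
  have RL: "SH_R L m = SH_R L n + j \<longleftrightarrow> 1 \<le> m \<and> SH_R L n + j - 1 = L m" for m
    using j by (auto simp: SH_R_def)
  show ?thesis
  proof (cases "\<exists>m. SH_R L m = SH_R L n + j")
    case True
    then obtain m where m: "SH_R L m = SH_R L n + j" by blast
    then have "(THE m. SH_R L m = SH_R L n + j) = m"
      using R(2) by (intro the_equality) metis+
    then show ?thesis using m RL[of m] k[of m] unfolding SH_a_def iff by auto
  next
    case False
    then have "\<kappa> (SH_R L n + j - 1) = 1" using RL by (intro 1) blast
    then show ?thesis using False unfolding SH_a_def iff by simp
  qed
qed

theorem theorem2p4:
  fixes T :: "'v pair_pre_digraph" and r :: 'v and L k :: "nat \<Rightarrow> nat"
  assumes "SH_tree_of_type T r L k"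
    and "normal_type L k"
  shows "unitarily_equivalent
           (pverts T) (laplacian T)
           (SIGMA (n, c):{(n, c). c < SH_M k n}. {1..})
           (op_direct_sum {(n, c). c < SH_M k n} (\<lambda>(n, c). {1..})
              (\<lambda>(n, c). jacobi (SH_a L k n) (SH_b n)))"
proof -
  obtain \<kappa> where L: "strict_mono_on {1..} L" and k1: "\<And>n. 1 \<le> n \<Longrightarrow> 1 < k n"
    and SH: "spherically_homogeneous T r \<kappa>"
    and k: "\<And>n. 1 \<le> n \<Longrightarrow> \<kappa> (L n) = k n"
    and 1: "\<And>j. (\<And>n. 1 \<le> n \<Longrightarrow> j \<noteq> L n) \<Longrightarrow> \<kappa> j = 1"
    using assms(1) unfolding SH_tree_of_type_def by blast
  interpret rooted_tree T r
    using SH by unfold_locales (auto simp: spherically_homogeneous_def)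
  have ch: "finite (children T r x)" "card (children T r x) = \<kappa> (depth x)" if "x \<in> pverts T" for x
    using SH that by (auto simp: spherically_homogeneous_def)
  have \<kappa>_pos: "0 < \<kappa> l" for l
  proof (cases "\<exists>n\<ge>1. l = L n")
    case True
    then show ?thesis using k k1 by fastforce
  next
    case False
    then have "\<kappa> l = 1" by (intro 1) blast
    then show ?thesis by simp
  qed
  interpret homogeneous_tree "pverts T" r depth parent \<kappa>
  proof unfold_locales
    show "parent x \<in> pverts T" "depth x = Suc (depth (parent x))" if "x \<in> pverts T" "x \<noteq> r" for x
      using parent[OF that] in_arcsD1 by blast+
  qed (use root depth_eq_0_iff ch \<kappa>_pos in \<open>simp_all add: children_eq\<close>)
  \<comment> \<open>The second component \<open>c\<close> numbers the copies of the
    \<open>n\<close>-th Jacobi matrix; all of them start at level \<open>SH_R L n\<close>.\<close>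
  let ?I = "{(n, c). c < SH_M k n}" and ?\<rho> = "\<lambda>(n, c :: nat). SH_R L n"
  have start: "finite {i\<in>?I. ?\<rho> i = Suc l} \<and>
      card {i\<in>?I. ?\<rho> i = Suc l} = card (level l) * (\<kappa> l - 1)" for l
  proof (cases "\<exists>n\<ge>1. l = L n")
    case True
    then obtain n where n: "1 \<le> n" "l = L n" by blast
    have "SH_R L m = Suc l \<longleftrightarrow> m = n" for m
      using strict_mono_eq[OF strict_mono_SH_R[OF L], of m n] n by (simp add: SH_R_def)
    then have "{i\<in>?I. ?\<rho> i = Suc l} = {n} \<times> {..<SH_M k n}" by auto
    then show ?thesis
      using card_level[of l] prod_branching[of L \<kappa> k, OF L k 1 n(1)] SH_M_eq[OF n(1), of k] k[OF n(1)] n(2)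
      by simp
  next
    case False
    then have no: "l \<noteq> L n" if "1 \<le> n" for n using that by blast
    have "SH_R L n \<noteq> Suc l" for n
      using no[of n] by (cases "n = 0") (auto simp: SH_R_def)
    then have "{i\<in>?I. ?\<rho> i = Suc l} = {}" by auto
    \<comment> \<open>Without branching there are no nontrivial modes:
      \<open>\<kappa> l - 1 = 0\<close> agrees with the empty set of starts.\<close>
    moreover have "\<kappa> l = 1" using no by (rule 1)
    ultimately show ?thesis by (simp only:) simp
  qed
  interpret graded_tree "pverts T" r depth parent \<kappa> ?I ?\<rho>
  proof unfold_locales
    \<comment> \<open>\<open>SH_R L n = 0\<close> forces \<open>n = 0\<close>, and
      \<open>SH_M k 0 = 1\<close> leaves one copy, the chain of radial functions that starts at the
      root.\<close>
    have "{i\<in>?I. ?\<rho> i = 0} = {(0, 0)}" by (auto simp: SH_R_def SH_M_def split: if_splits)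
    then show "\<exists>i0. {i\<in>?I. ?\<rho> i = 0} = {i0}" by blast
  qed (use start in auto)
  have "laplacian_action T f = tree_laplacian f" for f
  proof
    fix x
    show "laplacian_action T f x = tree_laplacian f x"
    proof (cases "x \<in> pverts T")
      case True
      then show ?thesis
        using laplacian_action_eq[OF True ch(1)] children_eq[OF True]
        by (simp add: tree_laplacian_def succs_def)
    qed (simp add: laplacian_action_def tree_laplacian_def)
  qed
  then have lap: "laplacian T = op_closure (pverts T) {(f, tree_laplacian f) | f. f \<in> finsupp (pverts T)}"
    by (simp add: laplacian_def)
  have b: "SH_b n = (\<lambda>_. 0)" for n by (simp add: SH_b_def fun_eq_iff)
  have J: "(\<lambda>(n, c). jacobi (SH_a L k n) (SH_b n)) = (\<lambda>i. jacobi (case i of (n, c) \<Rightarrow> SH_a L k n) (\<lambda>_. 0))"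
    unfolding b by (auto simp: fun_eq_iff)
  have X: "(\<lambda>(n, c). {1..}) = (\<lambda>_ :: nat \<times> nat. {1 :: nat ..})" by (simp add: fun_eq_iff)
  show ?thesis
    unfolding lap J X
    by (rule unitarily_equivalent_direct_sum) (auto simp: SH_a_eq[of L \<kappa> k, OF L k 1])
qed

end
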